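(* Let $n\geqslant 2$, let $D$ be a bounded domain in $\mathbb{R}^n$, let $D'$ be a domain in $\overline{\mathbb{R}^n}$, and let $Q:\mathbb{R}^n\to[0,\infty]$ be a Lebesgue measurable function with $Q(x)=0$ for $x\notin D$. Let $\mathfrak{R}_Q(D,D')$ be the family of all homeomorphisms $g:D'\to D$ of $D'$ onto $D$ such that $f=g^{-1}:D\to D'$ is a ring $Q$-homeomorphism in $D$. If $Q\in L^1(D)$, then the family $\mathfrak{R}_Q(D,D')$ is equicontinuous in $D'$, where $D'$ carries the chordal metric $h$ and $D$ carries the Euclidean metric; that is, for every $y_0\in D'$ and every $\varepsilon>0$ there is $\delta>0$ such that $|g(y)-g(y_0)|<\varepsilon$ for all $g\in\mathfrak{R}_Q(D,D')$ and all $y\in D'$ with $h(y,y_0)<\delta$.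
   Context: Notation: $\overline{\mathbb{R}^n}=\mathbb{R}^n\cup\{\infty\}$; boundaries and closures of sets are taken in $\overline{\mathbb{R}^n}$; $m$ is Lebesgue measure in $\mathbb{R}^n$. The chordal metric is $h(x,y)=\frac{|x-y|}{\sqrt{1+|x|^2}\sqrt{1+|y|^2}}$ for $x\neq\infty\neq y$, and $h(x,\infty)=\frac{1}{\sqrt{1+|x|^2}}$. Modulus: for a family $\Gamma$ of paths, $M(\Gamma)=\inf_\rho\int_{\mathbb{R}^n}\rho^n\,dm$, the infimum being over all Borel functions $\rho:\mathbb{R}^n\to[0,\infty]$ such that $\int_\gamma\rho\,ds\geqslant 1$ for every locally rectifiable $\gamma\in\Gamma$ (the conformal modulus in the sense of Väisälä; paths passing through $\infty$ are disregarded). For sets $E,F,D\subset\overline{\mathbb{R}^n}$, $\Gamma(E,F,D)$ is the family of all paths (continuous maps) $\gamma:[0,1]\to\overline{\mathbb{R}^n}$ with $\gamma(0)\in E$, $\gamma(1)\in F$ and $\gamma(t)\in D$ for all $t\in(0,1)$. For a mapping $f$ of $D$, $f(\Gamma)$ denotes the family of images under $f$ of the paths of $\Gamma$. Ring $Q$-mappings: for $x_0\in\overline{D}$, $x_0\neq\infty$, put $S_i=S(x_0,r_i)=\{x\in\mathbb{R}^n:|x-x_0|=r_i\}$, $i=1,2$, and $A=A(x_0,r_1,r_2)=\{x\in\mathbb{R}^n:r_1<|x-x_0|<r_2\}$. A mapping $f:D\to\overline{\mathbb{R}^n}$ is a ring $Q$-mapping at $x_0$ if $$M(f(\Gamma(S_1,S_2,D)))\leqslant\int_{A\cap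 D}Q(x)\,\eta^n(|x-x_0|)\,dm(x)$$ for all $0<r_1<r_2<d_0:=\sup_{x\in D}|x-x_0|$ and every measurable function $\eta:(r_1,r_2)\to[0,\infty]$ with $\int_{r_1}^{r_2}\eta(r)\,dr\geqslant 1$. For $E\subseteq\overline{D}$, $f$ is a ring $Q$-mapping in $E$ if it is a ring $Q$-mapping at every $x_0\in E$; if in addition $f$ is a homeomorphism (onto its image), it is called a ring $Q$-homeomorphism in $E$. *)

theory Defs
  imports "HOL-Analysis.Analysis"
begin

section \<open>The extended space\<close>

text \<open>The space \<open>\<real>\<^sup>n \<union> {\<infinity>}\<close> is the one-point compactification on \<open>(real ^ 'n) option\<close>;
  \<open>None\<close> is the point at infinity.\<close>

abbreviation Rbar :: "(real ^ 'n) option topology"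
  where "Rbar \<equiv> Alexandroff_compactification euclidean"

fun chordal :: "(real ^ 'n) option \<Rightarrow> (real ^ 'n) option \<Rightarrow> real" where
  "chordal (Some x) (Some y) =
     norm (x - y) / (sqrt (1 + (norm x)\<^sup>2) * sqrt (1 + (norm y)\<^sup>2))"
| "chordal (Some x) None = 1 / sqrt (1 + (norm x)\<^sup>2)"
| "chordal None (Some y) = 1 / sqrt (1 + (norm y)\<^sup>2)"
| "chordal None None = 0"

section \<open>Line integrals\<close>

text \<open>Length of \<open>\<gamma>\<close> on \<open>[a,b]\<close>: supremum over all finite partitions.\<close>

definition path_len :: "(real \<Rightarrow> 'a::metric_space) \<Rightarrow> real \<Rightarrow> real \<Rightarrow> ennreal" where
  "path_len \<gamma> a b =
     (SUP ts \<in> {ts. sorted ts \<and> set ts \<subseteq> {a..b}}.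
        ennreal (\<Sum>i<length ts - 1. dist (\<gamma> (ts ! i)) (\<gamma> (ts ! Suc i))))"

text \<open>Arc-length parametrization \<open>\<gamma>\<^sup>0\<close> on \<open>[0, path_len \<gamma> a b]\<close> of a rectifiable path on
  \<open>[a,b]\<close>, determined by \<open>\<gamma> t = \<gamma>\<^sup>0 (path_len \<gamma> a t)\<close>. The choice made by \<open>inv_into\<close> is
  irrelevant because \<open>\<gamma>\<close> is constant between parameters with the same \<open>path_len \<gamma> a t\<close>.\<close>

definition arc_param :: "(real \<Rightarrow> 'a::metric_space) \<Rightarrow> real \<Rightarrow> real \<Rightarrow> real \<Rightarrow> 'a" where
  "arc_param \<gamma> a b u = \<gamma> (inv_into {a..b} (\<lambda>t. enn2real (path_len \<gamma> a t)) u)"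

definition line_integral_closed ::
  "('a::metric_space \<Rightarrow> ennreal) \<Rightarrow> (real \<Rightarrow> 'a) \<Rightarrow> real \<Rightarrow> real \<Rightarrow> ennreal" where
  "line_integral_closed \<rho> \<gamma> a b =
     (\<integral>\<^sup>+ u \<in> {0..enn2real (path_len \<gamma> a b)}. \<rho> (arc_param \<gamma> a b u) \<partial>lborel)"

text \<open>Paths over an arbitrary (open, half-open or closed) interval \<open>I\<close>, as in Vaisala's
  lecture notes.\<close>

definition locally_rectifiable :: "real set \<Rightarrow> (real \<Rightarrow> 'a::metric_space) \<Rightarrow> bool" where
  "locally_rectifiable I \<gamma> \<longleftrightarrow> (\<forall>a\<in>I. \<forall>b\<in>I. a \<le> b \<longrightarrow> path_len \<gamma> a b < \<infinity>)"

definition line_integral ::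
  "('a::metric_space \<Rightarrow> ennreal) \<Rightarrow> real set \<Rightarrow> (real \<Rightarrow> 'a) \<Rightarrow> ennreal" where
  "line_integral \<rho> I \<gamma> =
     (SUP (a, b) \<in> {(a, b). a \<in> I \<and> b \<in> I \<and> a \<le> b}. line_integral_closed \<rho> \<gamma> a b)"

section \<open>The modulus\<close>

text \<open>A path family consists of pairs \<open>(I, \<gamma>)\<close> of a parameter interval and a path on it;
  paths through \<open>\<infinity>\<close> impose no condition on \<open>\<rho>\<close>.\<close>

definition admissible ::
  "(real set \<times> (real \<Rightarrow> (real ^ 'n) option)) set \<Rightarrow> (real ^ 'n \<Rightarrow> ennreal) set" where
  "admissible \<Gamma> =
     {\<rho> \<in> borel_measurable borel.
        \<forall>(I, \<gamma>) \<in> \<Gamma>. None \<notin> \<gamma> ` I \<and> locally_rectifiable I (the \<circ> \<gamma>)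
          \<longrightarrow> 1 \<le> line_integral \<rho> I (the \<circ> \<gamma>)}"

definition modulus :: "(real set \<times> (real \<Rightarrow> (real ^ 'n) option)) set \<Rightarrow> ennreal" where
  "modulus \<Gamma> = (INF \<rho> \<in> admissible \<Gamma>. \<integral>\<^sup>+ x. \<rho> x ^ CARD('n) \<partial>lebesgue)"

definition joining_paths ::
  "(real ^ 'n) option set \<Rightarrow> (real ^ 'n) option set \<Rightarrow> (real ^ 'n) option set
     \<Rightarrow> (real \<Rightarrow> (real ^ 'n) option) set" where
  "joining_paths E F D =
     {\<gamma>. continuous_map (top_of_set {0..1}) Rbar \<gamma> \<and> \<gamma> 0 \<in> E \<and> \<gamma> 1 \<in> F \<and>
         (\<forall>t\<in>{0<..<1}. \<gamma> t \<in> D)}"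

text \<open>The end points of a path of \<^term>\<open>joining_paths E F (Some ` D)\<close> need not lie in \<open>D\<close>, where
  \<open>f\<close> is defined. The image of such a path is \<open>f \<circ> \<gamma>\<close> on its natural domain, which is
  \<open>[0,1]\<close> with those of the points \<open>0\<close>, \<open>1\<close> removed that are not mapped into \<open>D\<close>.\<close>

definition image_family ::
  "(real ^ 'n \<Rightarrow> (real ^ 'n) option) \<Rightarrow> (real ^ 'n) set \<Rightarrow> (real \<Rightarrow> (real ^ 'n) option) set
     \<Rightarrow> (real set \<times> (real \<Rightarrow> (real ^ 'n) option)) set" where
  "image_family f D \<Gamma> = (\<lambda>\<gamma>. ({t \<in> {0..1}. \<gamma> t \<in> Some ` D}, f \<circ> the \<circ> \<gamma>)) ` \<Gamma>"

section \<open>Ring \<open>Q\<close>-mappings\<close>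

definition ring_Q_mapping_at ::
  "(real ^ 'n \<Rightarrow> ennreal) \<Rightarrow> (real ^ 'n) set \<Rightarrow> (real ^ 'n \<Rightarrow> (real ^ 'n) option)
     \<Rightarrow> real ^ 'n \<Rightarrow> bool" where
  "ring_Q_mapping_at Q D f x0 \<longleftrightarrow>
     (\<forall>r1 r2 \<eta>. 0 < r1 \<and> r1 < r2 \<and> ereal r2 < (SUP x\<in>D. ereal (norm (x - x0))) \<and>
        \<eta> \<in> borel_measurable (lebesgue_on {r1<..<r2}) \<and>
        (\<integral>\<^sup>+ r \<in> {r1<..<r2}. \<eta> r \<partial>lebesgue) \<ge> 1 \<longrightarrow>
        modulus (image_family f D
            (joining_paths (Some ` sphere x0 r1) (Some ` sphere x0 r2) (Some ` D)))
        \<le> (\<integral>\<^sup>+ x \<in> {x. r1 < norm (x - x0) \<and> norm (x - x0) < r2} \<inter> D.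
              Q x * \<eta> (norm (x - x0)) ^ CARD('n) \<partial>lebesgue))"

definition ring_Q_mapping ::
  "(real ^ 'n \<Rightarrow> ennreal) \<Rightarrow> (real ^ 'n) set \<Rightarrow> (real ^ 'n) set
     \<Rightarrow> (real ^ 'n \<Rightarrow> (real ^ 'n) option) \<Rightarrow> bool" where
  "ring_Q_mapping Q D E f \<longleftrightarrow> (\<forall>x0\<in>E. ring_Q_mapping_at Q D f x0)"

definition ring_Q_homeomorphism ::
  "(real ^ 'n \<Rightarrow> ennreal) \<Rightarrow> (real ^ 'n) set \<Rightarrow> (real ^ 'n) set
     \<Rightarrow> (real ^ 'n \<Rightarrow> (real ^ 'n) option) \<Rightarrow> bool" where
  "ring_Q_homeomorphism Q D E f \<longleftrightarrow>
     ring_Q_mapping Q D E f \<and> homeomorphic_map (top_of_set D) (subtopology Rbar (f ` D)) f"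

definition ring_family ::
  "(real ^ 'n \<Rightarrow> ennreal) \<Rightarrow> (real ^ 'n) set \<Rightarrow> (real ^ 'n) option set
     \<Rightarrow> ((real ^ 'n) option \<Rightarrow> real ^ 'n) set" where
  "ring_family Q D D' =
     {g. homeomorphic_map (subtopology Rbar D') (top_of_set D) g \<and>
         ring_Q_homeomorphism Q D D (inv_into D' g)}"

end

theory Submission
  imports Defs
begin

text \<open>Let \<open>g\<close> be in the family and suppose that \<open>\<bar>g y - g y0\<bar> \<ge> \<epsilon>\<close>. Covering \<open>D\<close> by finitely many small
  balls and combining nearly optimal densities for the corresponding rings (with constant \<open>\<eta>\<close>), one
  gets a density \<open>\<rho>\<close> with \<open>\<integral> \<rho>\<^sup>n \<le> C\<close>, where \<open>C\<close> depends only on \<open>D\<close>, \<open>Q\<close> and \<open>\<epsilon>\<close>, such that every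
  segment in \<open>D'\<close> whose end points have \<open>g\<close>-images at distance at least \<open>\<epsilon> / 6\<close> has \<open>\<rho>\<close>-length at
  least \<open>1\<close>.

  If a cube (or, for \<open>y0 = \<infinity>\<close>, the complement of a cube) contained in \<open>D'\<close> contains \<open>y\<close> and \<open>y0\<close>, then
  \<open>g\<close> oscillates by at least \<open>\<epsilon>\<close> on its surface, since the diameter of a compact set is attained on
  its frontier. Hence \<open>g\<close> oscillates by at least \<open>\<epsilon> / 3\<close> on one of the faces. As \<open>n\<close> exceeds the
  dimension \<open>n - 1\<close> of the face, Morrey's argument bounds the integral of \<open>\<rho>\<^sup>n\<close> over the hyperplane of
  the face from below by \<open>c / r\<close>, where \<open>2 r\<close> is the side length. Integration over \<open>r\<close> yields
  \<open>c ln (r2 / r1) \<le> 2 n C\<close>, which fails when \<open>y\<close> is close to \<open>y0\<close>.\<close>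

section \<open>Slices by coordinate hyperplanes\<close>

lemma nn_integral_lborel_shift:
  fixes f :: "'a::euclidean_space \<Rightarrow> ennreal"
  assumes [measurable]: "f \<in> borel_measurable borel"
  shows "(\<integral>\<^sup>+x. f (x + c) \<partial>lborel) = (\<integral>\<^sup>+x. f x \<partial>lborel)"
proof -
  have "(\<integral>\<^sup>+x. f x \<partial>lborel) = (\<integral>\<^sup>+x. f x \<partial>distr lborel borel ((+) c))"
    by (simp add: lborel_distr_plus)
  also have "\<dots> = (\<integral>\<^sup>+x. f (c + x) \<partial>lborel)"
    by (subst nn_integral_distr) auto
  finally show ?thesis by (simp add: add.commute)
qed

text \<open>Fubini with a dummy coordinate: translating \<open>s\<close> by
  \<open>x \<bullet> b\<close> and then \<open>x\<close> by \<open>s *\<^sub>R b\<close> leaves the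
  only dependence on \<open>s\<close> in the indicator, whose integral over \<open>s\<close> is
  1.\<close>

lemma nn_integral_slices:
  fixes h :: "'a::euclidean_space \<Rightarrow> ennreal"
  assumes [measurable]: "h \<in> borel_measurable borel" and b: "b \<in> Basis"
  shows "(\<integral>\<^sup>+s. (\<integral>\<^sup>+x. indicator {0..1} (x \<bullet> b) * h (x + (s - x \<bullet> b) *\<^sub>R b) \<partial>lborel) \<partial>lborel)
           = (\<integral>\<^sup>+x. h x \<partial>lborel)"
proof -
  let ?i = "indicator {0..1::real} :: real \<Rightarrow> ennreal"
  have "(\<integral>\<^sup>+s. (\<integral>\<^sup>+x. ?i (x \<bullet> b) * h (x + (s - x \<bullet> b) *\<^sub>R b) \<partial>lborel) \<partial>lborel)
      = (\<integral>\<^sup>+x. (\<integral>\<^sup>+s. ?i (x \<bullet> b) * h (x + (s - x \<bullet> b) *\<^sub>R b) \<partial>lborel) \<partial>lborel)"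
    by (rule lborel_pair.Fubini') measurable
  also have "\<dots> = (\<integral>\<^sup>+x. (\<integral>\<^sup>+s. ?i (x \<bullet> b) * h (x + s *\<^sub>R b) \<partial>lborel) \<partial>lborel)"
  proof (rule nn_integral_cong)
    fix x :: 'a
    show "(\<integral>\<^sup>+s. ?i (x \<bullet> b) * h (x + (s - x \<bullet> b) *\<^sub>R b) \<partial>lborel)
        = (\<integral>\<^sup>+s. ?i (x \<bullet> b) * h (x + s *\<^sub>R b) \<partial>lborel)"
      using nn_integral_lborel_shift[of "\<lambda>s. ?i (x \<bullet> b) * h (x + s *\<^sub>R b)" "- (x \<bullet> b)"]
      by simp
  qed
  also have "\<dots> = (\<integral>\<^sup>+s. (\<integral>\<^sup>+x. ?i (x \<bullet> b) * h (x + s *\<^sub>R b) \<partial>lborel) \<partial>lborel)"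
    by (rule lborel_pair.Fubini'[symmetric]) measurable
  also have "\<dots> = (\<integral>\<^sup>+s. (\<integral>\<^sup>+x. ?i (x \<bullet> b - s) * h x \<partial>lborel) \<partial>lborel)"
  proof (rule nn_integral_cong)
    fix s :: real
    show "(\<integral>\<^sup>+x. ?i (x \<bullet> b) * h (x + s *\<^sub>R b) \<partial>lborel) = (\<integral>\<^sup>+x. ?i (x \<bullet> b - s) * h x \<partial>lborel)"
      using nn_integral_lborel_shift[of "\<lambda>x. ?i (x \<bullet> b - s) * h x" "s *\<^sub>R b"] b
      by (simp add: inner_add_left)
  qed
  also have "\<dots> = (\<integral>\<^sup>+x. (\<integral>\<^sup>+s. ?i (x \<bullet> b - s) * h x \<partial>lborel) \<partial>lborel)"
    by (rule lborel_pair.Fubini') measurable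
  also have "\<dots> = (\<integral>\<^sup>+x. h x \<partial>lborel)"
  proof (rule nn_integral_cong)
    fix x :: 'a
    have "(\<integral>\<^sup>+s. ?i (x \<bullet> b - s) * h x \<partial>lborel) = (\<integral>\<^sup>+s. ?i (x \<bullet> b - s) \<partial>lborel) * h x"
      by (rule nn_integral_multc) measurable
    moreover have "(\<lambda>s. ?i (x \<bullet> b - s)) = indicator {x \<bullet> b - 1 .. x \<bullet> b}"
      by (auto simp: indicator_def fun_eq_iff)
    then have "(\<integral>\<^sup>+s. ?i (x \<bullet> b - s) \<partial>lborel) = 1" by simp
    ultimately show "(\<integral>\<^sup>+s. ?i (x \<bullet> b - s) * h x \<partial>lborel) = h x" by simp
  qed
  finally show ?thesis .
qed


text \<open>For \<open>b \<in> Basis\<close> this is the orthogonal projection onto a coordinate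
  hyperplane.\<close>

definition slice :: "'a::euclidean_space \<Rightarrow> real \<Rightarrow> 'a \<Rightarrow> 'a" where
  "slice b s x = x + (s - x \<bullet> b) *\<^sub>R b"

lemma slice_inner: "b \<in> Basis \<Longrightarrow> j \<in> Basis \<Longrightarrow> slice b s x \<bullet> j = (if j = b then s else x \<bullet> j)"
  by (simp add: slice_def inner_add_left inner_Basis)

lemma borel_measurable_slice [measurable]: "slice b s \<in> borel_measurable borel"
  unfolding slice_def by measurable

text \<open>Integral over the hyperplane \<open>x \<bullet> b = s\<close>. The coordinate \<open>x \<bullet> b\<close>, on which \<open>slice b s x\<close> does
  not depend, runs over a unit interval, so that no lower-dimensional measure is needed.\<close>

definition slice_int :: "('a::euclidean_space \<Rightarrow> ennreal) \<Rightarrow> 'a \<Rightarrow> real \<Rightarrow> ennreal" where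
  "slice_int h b s = (\<integral>\<^sup>+x. indicator {0..1} (x \<bullet> b) * h (slice b s x) \<partial>lborel)"

lemma nn_integral_slice_int:
  assumes "h \<in> borel_measurable borel" "b \<in> Basis"
  shows "(\<integral>\<^sup>+s. slice_int h b s \<partial>lborel) = (\<integral>\<^sup>+x. h x \<partial>lborel)"
  using nn_integral_slices[OF assms] by (simp add: slice_int_def slice_def)

lemma borel_measurable_slice_int [measurable]:
  assumes [measurable]: "h \<in> borel_measurable borel"
  shows "slice_int h b \<in> borel_measurable borel"
  unfolding slice_int_def slice_def by measurable

text \<open>Change of variables within the hyperplane: there the homothety with centre
  \<open>p\<close> and ratio \<open>t\<close> has Jacobian \<open>t ^ (n - 1)\<close>, n being the
  dimension of the space.\<close>

lemma slice_int_homothety: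
  fixes h :: "'a::euclidean_space \<Rightarrow> ennreal"
  assumes [measurable]: "h \<in> borel_measurable borel" and b: "b \<in> Basis"
    and p: "p \<bullet> b = s" and t: "0 < t"
  shows "ennreal (t ^ (DIM('a) - 1)) *
           (\<integral>\<^sup>+x. indicator {0..1} (x \<bullet> b) * h (p + t *\<^sub>R (slice b s x - p)) \<partial>lborel)
         = slice_int h b s"
proof -
  \<comment> \<open>The map \<open>T\<close> acts as this homothety in the coordinates other than
    \<open>b\<close> and as the identity in the dummy coordinate \<open>b\<close>, so the weight on
    \<open>x \<bullet> b\<close> is untouched.\<close>
  define c where "c j = (if j = b then 1 else t)" for j :: 'a
  define t0 where "t0 = (1 - t) *\<^sub>R (p - s *\<^sub>R b)"
  define T where "T x = t0 + (\<Sum>j\<in>Basis. (c j * (x \<bullet> j)) *\<^sub>R j)" for x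
  have [measurable]: "T \<in> borel_measurable borel" unfolding T_def by measurable
  have Tj: "T x \<bullet> j = t0 \<bullet> j + c j * (x \<bullet> j)" if "j \<in> Basis" for x j
    using that by (simp add: T_def inner_add_left inner_sum_left inner_Basis if_distrib cong: if_cong)
  have t0b: "t0 \<bullet> b = 0" using b p by (simp add: t0_def inner_diff_left)
  have Tb: "T x \<bullet> b = x \<bullet> b" for x using b by (simp add: Tj t0b c_def)
  have sl: "slice b s (T x) = p + t *\<^sub>R (slice b s x - p)" for x
  proof (rule euclidean_eqI)
    fix j :: 'a assume j: "j \<in> Basis"
    show "slice b s (T x) \<bullet> j = (p + t *\<^sub>R (slice b s x - p)) \<bullet> j"
    proof (cases "j = b")
      case True then show ?thesis using b p j
        by (simp add: slice_inner inner_add_left inner_diff_left)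
    next
      case False then show ?thesis using b p j
        by (simp add: slice_inner inner_add_left inner_diff_left Tj c_def t0_def inner_Basis algebra_simps)
    qed
  qed
  have pr: "(\<Prod>j\<in>Basis. \<bar>c j\<bar>) = t ^ (DIM('a) - 1)"
    using b t by (subst prod.remove[OF _ b]) (auto simp: c_def)
  have "slice_int h b s = (\<integral>\<^sup>+x. indicator {0..1} (x \<bullet> b) * h (slice b s x)
          \<partial>density (distr lborel borel T) (\<lambda>_. (\<Prod>j\<in>Basis. \<bar>c j\<bar>)))"
    unfolding slice_int_def T_def
    by (subst lborel_affine_euclidean[of c t0]) (use t in \<open>auto simp: c_def\<close>)
  also have "\<dots> = ennreal (t ^ (DIM('a) - 1)) * (\<integral>\<^sup>+x. indicator {0..1} (x \<bullet> b) * h (slice b s x)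
          \<partial>distr lborel borel T)"
    unfolding pr by (subst nn_integral_density) (auto intro!: nn_integral_cmult)
  also have "(\<integral>\<^sup>+x. indicator {0..1} (x \<bullet> b) * h (slice b s x) \<partial>distr lborel borel T)
     = (\<integral>\<^sup>+x. indicator {0..1} (x \<bullet> b) * h (p + t *\<^sub>R (slice b s x - p)) \<partial>lborel)"
    by (subst nn_integral_distr) (auto simp: Tb sl)
  finally show ?thesis ..
qed

text \<open>Either \<open>a \<le> d\<close>, or \<open>a / d \<ge> 1\<close> and then
  \<open>a \<le> a * (a / d) ^ m\<close>. This takes the place of Hoelder's inequality; the
  parameter \<open>d\<close> may vary along a segment.\<close>

lemma ennreal_young:
  fixes a :: ennreal
  assumes "0 < d"
  shows "a \<le> ennreal d + ennreal (inverse d ^ m) * a ^ Suc m"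
proof (cases a)
  case (real x)
  show ?thesis
  proof (cases "x \<le> d")
    case True then show ?thesis using real assms by (simp add: add_increasing2 ennreal_leI)
  next
    case False
    then have "1 \<le> (x / d) ^ m" using assms by (intro one_le_power) auto
    then have "x * 1 \<le> x * (x / d) ^ m" using real by (intro mult_left_mono) auto
    also have "\<dots> = inverse d ^ m * x ^ Suc m" by (simp add: field_simps)
    finally have "x \<le> inverse d ^ m * x ^ Suc m" by simp
    then have "ennreal x \<le> ennreal (inverse d ^ m) * ennreal x ^ Suc m"
      using real assms by (simp add: ennreal_mult'' ennreal_power ennreal_leI flip: power_Suc)
        (smt (verit) ennreal_leI ennreal_mult' inverse_nonnegative_iff_nonnegative zero_le_power)
    then show ?thesis using real by (simp add: add_increasing)
  qed
next
  case top
  then show ?thesis using assms by (simp add: ennreal_mult_top ennreal_top_mult ennreal_mult_eq_top_iff)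
qed

lemma nn_integral_powr_unit:
  assumes "-1 < a"
  shows "(\<integral>\<^sup>+t. ennreal (t powr a) * indicator {0..1} t \<partial>lborel) = ennreal (1 / (a + 1))"
  using nn_integral_has_integral_lebesgue'[OF _ has_integral_powr_from_0[OF assms, of 1]] by simp

section \<open>Morrey estimate on the face of a cube\<close>

text \<open>The integral of \<open>\<rho>\<close> with respect to arc length along the segment from
  \<open>p\<close> to \<open>q\<close>, in the constant-speed parametrization.\<close>

definition seg_int :: "('a::euclidean_space \<Rightarrow> ennreal) \<Rightarrow> 'a \<Rightarrow> 'a \<Rightarrow> ennreal" where
  "seg_int \<rho> p q = ennreal (norm (q - p)) *
     (\<integral>\<^sup>+t. \<rho> (p + t *\<^sub>R (q - p)) * indicator {0..1} t \<partial>lborel)"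

text \<open>With \<open>b \<in> Basis\<close>, \<open>s = c \<bullet> b + \<sigma> * r\<close> and
  \<open>\<sigma> \<in> {1, -1}\<close> these are the faces of the cube with centre \<open>c\<close>
  and side length \<open>2 * r\<close>.\<close>

definition face :: "'a::euclidean_space \<Rightarrow> real \<Rightarrow> 'a \<Rightarrow> real \<Rightarrow> 'a set" where
  "face b s c r = {x. x \<bullet> b = s \<and> (\<forall>j\<in>Basis - {b}. \<bar>(x - c) \<bullet> j\<bar> \<le> r)}"

text \<open>The face thickened to a unit interval in direction \<open>b\<close>, matching the dummy coordinate of
  \<open>slice_int\<close>.\<close>

definition slab :: "'a::euclidean_space \<Rightarrow> 'a \<Rightarrow> real \<Rightarrow> 'a set" where
  "slab b c r = {x. 0 \<le> x \<bullet> b \<and> x \<bullet> b \<le> 1 \<and> (\<forall>j\<in>Basis - {b}. \<bar>(x - c) \<bullet> j\<bar> \<le> r)}"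

lemma slice_in_face: "b \<in> Basis \<Longrightarrow> x \<in> slab b c r \<Longrightarrow> slice b s x \<in> face b s c r"
  by (auto simp: slab_def face_def slice_inner inner_diff_left)

lemma slab_eq_cbox:
  fixes c :: "'a::euclidean_space"
  assumes b: "b \<in> Basis"
  shows "slab b c r = cbox (\<Sum>j\<in>Basis. (if j = b then 0 else c \<bullet> j - r) *\<^sub>R j)
                           (\<Sum>j\<in>Basis. (if j = b then 1 else c \<bullet> j + r) *\<^sub>R j)"
  using b by (auto simp: slab_def mem_box inner_diff_left abs_le_iff algebra_simps split: if_splits)

lemma sets_slab [measurable]: "b \<in> Basis \<Longrightarrow> slab b c r \<in> sets borel"
  by (simp add: slab_eq_cbox)

lemma emeasure_slab:
  fixes c :: "'a::euclidean_space"
  assumes b: "b \<in> Basis" and r: "0 < r"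
  shows "emeasure lborel (slab b c r) = ennreal ((2 * r) ^ (DIM('a) - 1))"
proof -
  let ?l = "\<Sum>j\<in>Basis. (if j = b then 0 else c \<bullet> j - r) *\<^sub>R j"
  let ?u = "\<Sum>j\<in>Basis. (if j = b then 1 else c \<bullet> j + r) *\<^sub>R j"
  have "emeasure lborel (cbox ?l ?u) = (\<Prod>j\<in>Basis. (?u - ?l) \<bullet> j)"
    by (rule emeasure_lborel_cbox) (use r in \<open>auto\<close>)
  also have "(\<Prod>j\<in>Basis. (?u - ?l) \<bullet> j) = (\<Prod>j\<in>Basis. if j = b then 1 else 2 * r)"
    by (intro prod.cong) (auto simp: inner_diff_left)
  also have "\<dots> = (2 * r) ^ (DIM('a) - 1)"
    using b by (subst prod.remove[OF _ b]) auto
  finally show ?thesis by (simp add: slab_eq_cbox[OF b])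
qed

lemma norm_diff_face:
  fixes c :: "'a::euclidean_space"
  assumes "b \<in> Basis" "0 < r" "p \<in> face b s c r" "q \<in> face b s c r"
  shows "norm (q - p) \<le> 2 * r * DIM('a)"
proof -
  have "norm (q - p) \<le> (\<Sum>j\<in>Basis. \<bar>(q - p) \<bullet> j\<bar>)" by (rule norm_le_l1)
  also have "\<dots> \<le> (\<Sum>j\<in>(Basis::'a set). 2 * r)"
  proof (rule sum_mono)
    fix j :: 'a assume j: "j \<in> Basis"
    show "\<bar>(q - p) \<bullet> j\<bar> \<le> 2 * r"
    proof (cases "j = b")
      case False
      then have "\<bar>(q - c) \<bullet> j\<bar> \<le> r" "\<bar>(p - c) \<bullet> j\<bar> \<le> r" using assms j by (auto simp: face_def)
      then show ?thesis by (simp add: inner_diff_left)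
    qed (use assms in \<open>auto simp: face_def inner_diff_left\<close>)
  qed
  also have "\<dots> = 2 * r * DIM('a)" by simp
  finally show ?thesis .
qed

text \<open>Morrey's averaging over all segments from \<open>p\<close> to points of the face. At
  time \<open>t\<close> they fill a copy of the face shrunk by the factor \<open>t\<close> towards
  \<open>p\<close>. Young's inequality with a parameter depending on \<open>t\<close>, followed by
  the homothety formula, bounds its contribution by the hyperplane integral of
  \<open>\<rho> ^ N\<close>. The constant \<open>\<kappa>\<close> stays free to balance the two
  terms.\<close>

lemma nn_integral_seg_int_le:
  fixes c p :: "'a::euclidean_space"
  assumes [measurable]: "\<rho> \<in> borel_measurable borel"
    and b: "b \<in> Basis" and r: "0 < r" and \<kappa>: "0 < \<kappa>" and p: "p \<in> face b s c r"
  defines "N \<equiv> DIM('a)"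
  shows "(\<integral>\<^sup>+x. seg_int \<rho> p (slice b s x) * indicator (slab b c r) x \<partial>lborel)
      \<le> ennreal (2 * r * N) * (ennreal (\<kappa> * N * (2 * r) ^ (N - 1)) +
          ennreal (inverse \<kappa> ^ (N - 1) * N) * slice_int (\<lambda>x. \<rho> x ^ N) b s)"
proof -
  define m where "m = N - 1"
  have N0: "N > 0" by (simp add: N_def)
  then have N: "N = Suc m" by (simp add: m_def)
  define \<alpha> where "\<alpha> = real m / real N"
  have \<alpha>: "0 \<le> \<alpha>" "\<alpha> < 1" "1 - \<alpha> = 1 / N" using N by (auto simp: \<alpha>_def field_simps)
  \<comment> \<open>With this exponent both \<open>d t\<close> and \<open>d t powr - m * t powr - m\<close> (the latter from the homothety
    with ratio \<open>t\<close>) are multiples of \<open>t powr - \<alpha>\<close>, which is integrable as \<open>\<alpha> < 1\<close>.\<close>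
  define d where "d t = \<kappa> * t powr (-\<alpha>)" for t :: real
  define P where "P = slice_int (\<lambda>x. \<rho> x ^ N) b s"
  define L where "L = 2 * r * N"
  let ?F = "indicator (slab b c r) :: 'a \<Rightarrow> ennreal"
  let ?I = "indicator {0..1::real} :: real \<Rightarrow> ennreal"
  let ?R = "\<lambda>x t. \<rho> (p + t *\<^sub>R (slice b s x - p))"
  have ps: "p \<bullet> b = s" using p by (simp add: face_def)
  have [measurable]: "slab b c r \<in> sets borel" using b by measurable
  have d[measurable]: "d \<in> borel_measurable borel" unfolding d_def by measurable
  have dpos: "d t > 0" if "t > 0" for t using that \<kappa> by (simp add: d_def)
  have m1: "(\<lambda>(x,t). ?R x t) \<in> borel_measurable (lborel \<Otimes>\<^sub>M lborel)"
    unfolding slice_def by measurable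
  note [measurable] = m1[unfolded case_prod_unfold]
  have I_d: "(\<integral>\<^sup>+t. ennreal (t powr (-\<alpha>)) * ?I t \<partial>lborel) = ennreal N"
    using nn_integral_powr_unit[of "-\<alpha>"] \<alpha> by simp
  \<comment> \<open>The parameter \<open>t = 0\<close> has to be discarded below, since
    \<open>0 powr (-\<alpha>)\<close> is 0 by convention and the pointwise bound may fail
    there.\<close>
  have AE0: "AE t in lborel. t \<noteq> (0::real)" by (rule AE_lborel_singleton)
  \<comment> \<open>Dropping the restriction to the face leaves an integral over the whole
    hyperplane, on which the homothety acts by the factor \<open>t ^ m\<close>.\<close>
  have inner: "(\<integral>\<^sup>+x. ?R x t ^ N * ?F x \<partial>lborel) \<le> ennreal (inverse (t ^ m)) * P" if "t > 0" for t
  proof -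
    have "ennreal (t ^ m) * (\<integral>\<^sup>+x. ?R x t ^ N * ?F x \<partial>lborel) \<le>
          ennreal (t ^ m) * (\<integral>\<^sup>+x. indicator {0..1} (x \<bullet> b) * ?R x t ^ N \<partial>lborel)"
      by (intro mult_left_mono nn_integral_mono) (auto simp: indicator_def slab_def)
    also have "\<dots> = P"
      unfolding P_def m_def N_def by (rule slice_int_homothety) (use b ps that in auto)
    finally have "ennreal (t ^ m) * (\<integral>\<^sup>+x. ?R x t ^ N * ?F x \<partial>lborel) \<le> P" .
    then have "ennreal (inverse (t ^ m)) * (ennreal (t ^ m) * (\<integral>\<^sup>+x. ?R x t ^ N * ?F x \<partial>lborel)) \<le>
         ennreal (inverse (t ^ m)) * P" by (rule mult_left_mono) simp
    moreover have "ennreal (inverse (t ^ m)) * ennreal (t ^ m) = 1"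
      using that by (simp add: ennreal_mult'[symmetric])
    ultimately show ?thesis by (simp add: mult.assoc[symmetric])
  qed
  have pw: "inverse (d t) ^ m * inverse (t ^ m) = inverse \<kappa> ^ m * t powr (-\<alpha>)" if "t > 0" for t
  proof -
    have "inverse (d t) ^ m * inverse (t ^ m) = inverse \<kappa> ^ m * ((t powr \<alpha>) ^ m * inverse (t ^ m))"
      by (simp add: d_def powr_minus power_mult_distrib power_inverse)
    also have "(t powr \<alpha>) ^ m * inverse (t ^ m) = t powr (\<alpha> * m) * t powr (- real m)"
      using that by (simp add: powr_minus powr_realpow powr_power mult.commute)
    also have "\<dots> = t powr (\<alpha> * m - m)" by (simp add: powr_add[symmetric])
    also have "\<alpha> * m - m = - \<alpha>" using N by (simp add: \<alpha>_def field_simps)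
    finally show ?thesis .
  qed
  have "(\<integral>\<^sup>+x. seg_int \<rho> p (slice b s x) * ?F x \<partial>lborel) \<le>
     (\<integral>\<^sup>+x. ennreal L * (\<integral>\<^sup>+t. ?R x t * ?I t * ?F x \<partial>lborel) \<partial>lborel)"
  proof (rule nn_integral_mono)
    fix x
    show "seg_int \<rho> p (slice b s x) * ?F x \<le> ennreal L * (\<integral>\<^sup>+t. ?R x t * ?I t * ?F x \<partial>lborel)"
    proof (cases "x \<in> slab b c r")
      case True
      then have "norm (slice b s x - p) \<le> L"
        unfolding L_def N_def by (intro norm_diff_face[OF b r p] slice_in_face b)
      then show ?thesis using True by (auto simp: seg_int_def intro!: mult_right_mono ennreal_leI)
    qed simp
  qed
  also have "\<dots> = ennreal L * (\<integral>\<^sup>+x. (\<integral>\<^sup>+t. ?R x t * ?I t * ?F x \<partial>lborel) \<partial>lborel)"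
    by (rule nn_integral_cmult) measurable
  also have "(\<integral>\<^sup>+x. (\<integral>\<^sup>+t. ?R x t * ?I t * ?F x \<partial>lborel) \<partial>lborel)
      = (\<integral>\<^sup>+t. (\<integral>\<^sup>+x. ?R x t * ?I t * ?F x \<partial>lborel) \<partial>lborel)"
    by (rule lborel_pair.Fubini') measurable
  also have "\<dots> \<le> (\<integral>\<^sup>+t. ennreal (\<kappa> * (2 * r) ^ m) * (ennreal (t powr (-\<alpha>)) * ?I t)
       + ennreal (inverse \<kappa> ^ m) * P * (ennreal (t powr (-\<alpha>)) * ?I t) \<partial>lborel)"
  proof (rule nn_integral_mono_AE, use AE0 in eventually_elim)
    fix t :: real assume "t \<noteq> 0"
    show "(\<integral>\<^sup>+x. ?R x t * ?I t * ?F x \<partial>lborel) \<le> ennreal (\<kappa> * (2 * r) ^ m) * (ennreal (t powr (-\<alpha>)) * ?I t)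
       + ennreal (inverse \<kappa> ^ m) * P * (ennreal (t powr (-\<alpha>)) * ?I t)"
    proof (cases "t \<in> {0..1}")
      case True
      then have t: "t > 0" using \<open>t \<noteq> 0\<close> by auto
      have "(\<integral>\<^sup>+x. ?R x t * ?I t * ?F x \<partial>lborel) \<le>
         (\<integral>\<^sup>+x. ennreal (d t) * ?F x + ennreal (inverse (d t) ^ m) * (?R x t ^ N * ?F x) \<partial>lborel)"
      proof (rule nn_integral_mono)
        fix x
        show "?R x t * ?I t * ?F x \<le> ennreal (d t) * ?F x + ennreal (inverse (d t) ^ m) * (?R x t ^ N * ?F x)"
          using True ennreal_young[OF dpos[OF t], of "?R x t" m] by (simp add: indicator_def N)
      qed
      also have "\<dots> = ennreal (d t) * emeasure lborel (slab b c r)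
          + ennreal (inverse (d t) ^ m) * (\<integral>\<^sup>+x. ?R x t ^ N * ?F x \<partial>lborel)"
        by (simp add: nn_integral_add nn_integral_cmult)
      also have "\<dots> \<le> ennreal (d t) * ennreal ((2 * r) ^ m)
          + ennreal (inverse (d t) ^ m) * (ennreal (inverse (t ^ m)) * P)"
        using inner[OF t] b r by (intro add_mono mult_left_mono) (auto simp: emeasure_slab m_def N_def)
      also have "ennreal (inverse (d t) ^ m) * (ennreal (inverse (t ^ m)) * P)
          = ennreal (inverse \<kappa> ^ m * t powr (-\<alpha>)) * P"
        unfolding pw[OF t, symmetric] using t dpos[OF t]
        by (subst ennreal_mult) (auto simp: mult.assoc)
      finally show ?thesis using True r \<kappa> by (simp add: ennreal_mult d_def mult_ac)
    qed simp
  qed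
  also have "\<dots> = ennreal (\<kappa> * (2 * r) ^ m) * ennreal N + ennreal (inverse \<kappa> ^ m) * P * ennreal N"
    by (simp add: nn_integral_add nn_integral_cmult I_d)
  also have "\<dots> = ennreal (\<kappa> * N * (2 * r) ^ m) + ennreal (inverse \<kappa> ^ m * N) * P"
    using \<kappa> r by (simp add: ennreal_mult mult_ac)
  finally show ?thesis unfolding L_def m_def P_def by (simp add: mult_left_mono)
qed

text \<open>By \<open>long\<close>, the averages from \<open>p\<close> and from \<open>q\<close> add
  up to at least the volume of the face. Comparison with the upper bound just proved gives a lower
  bound for the hyperplane integral; it scales like \<open>1 / r\<close> because the exponent
  \<open>N\<close> exceeds the dimension of the face by one.\<close>

lemma slice_int_ge_of_seg_int:
  fixes c p q :: "'a::euclidean_space"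
  assumes [measurable]: "\<rho> \<in> borel_measurable borel"
    and b: "b \<in> Basis" and r: "0 < r" and p: "p \<in> face b s c r" and q: "q \<in> face b s c r"
    and long: "\<And>z. z \<in> face b s c r \<Longrightarrow> 1 \<le> seg_int \<rho> p z \<or> 1 \<le> seg_int \<rho> q z"
  defines "N \<equiv> DIM('a)"
  shows "ennreal (inverse ((8 * (real N)\<^sup>2) ^ N * r)) \<le> slice_int (\<lambda>x. \<rho> x ^ N) b s"
proof (cases "slice_int (\<lambda>x. \<rho> x ^ N) b s")
  case (real P)
  define m where "m = N - 1"
  have N0: "N > 0" by (simp add: N_def)
  then have N: "N = Suc m" by (simp add: m_def)
  \<comment> \<open>With this value the first term of \<open>2 * B\<close> is exactly half of
    \<open>(2 * r) ^ m\<close> and can be absorbed on the left.\<close>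
  define \<kappa> where "\<kappa> = 1 / (8 * r * N\<^sup>2)"
  have \<kappa>: "\<kappa> > 0" using r N by (simp add: \<kappa>_def)
  let ?F = "indicator (slab b c r) :: 'a \<Rightarrow> ennreal"
  have [measurable]: "slab b c r \<in> sets borel" using b by measurable
  define B where "B = 2 * r * N * (\<kappa> * N * (2 * r) ^ m + inverse \<kappa> ^ m * N * P)"
  have m[measurable]: "(\<lambda>x. seg_int \<rho> a (slice b s x)) \<in> borel_measurable borel" for a
    unfolding seg_int_def slice_def by measurable
  have le: "(\<integral>\<^sup>+x. seg_int \<rho> a (slice b s x) * ?F x \<partial>lborel) \<le> ennreal B" if "a \<in> face b s c r" for a
    using nn_integral_seg_int_le[OF assms(1) b r \<kappa> that] real r \<kappa> N
    unfolding B_def N_def[symmetric] m_def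
    by (simp add: ennreal_mult)
  have "ennreal ((2 * r) ^ m) = (\<integral>\<^sup>+x. ?F x \<partial>lborel)"
    using b r by (simp add: emeasure_slab m_def N_def)
  also have "\<dots> \<le> (\<integral>\<^sup>+x. seg_int \<rho> p (slice b s x) * ?F x + seg_int \<rho> q (slice b s x) * ?F x \<partial>lborel)"
  proof (rule nn_integral_mono)
    fix x
    show "?F x \<le> seg_int \<rho> p (slice b s x) * ?F x + seg_int \<rho> q (slice b s x) * ?F x"
      using long[OF slice_in_face[OF b], of x] by (auto simp: indicator_def add_increasing add_increasing2)
  qed
  also have "\<dots> = (\<integral>\<^sup>+x. seg_int \<rho> p (slice b s x) * ?F x \<partial>lborel) + (\<integral>\<^sup>+x. seg_int \<rho> q (slice b s x) * ?F x \<partial>lborel)"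
    by (rule nn_integral_add) measurable
  also have "\<dots> \<le> ennreal B + ennreal B" by (intro add_mono le p q)
  also have "\<dots> = ennreal (2 * B)" using r \<kappa> real by (simp add: B_def flip: ennreal_plus)
  finally have "(2 * r) ^ m \<le> 2 * B"
    using r \<kappa> real by (subst (asm) ennreal_le_iff) (auto simp: B_def)
  also have "2 * B = (4 * r * N\<^sup>2 * \<kappa>) * (2 * r) ^ m + (4 * r * N\<^sup>2) * inverse \<kappa> ^ m * P"
    by (simp add: B_def algebra_simps power2_eq_square)
  also have "4 * r * N\<^sup>2 * \<kappa> = 1 / 2" using r N by (simp add: \<kappa>_def)
  finally have "(2 * r) ^ m \<le> 2 * ((4 * r * N\<^sup>2) * inverse \<kappa> ^ m * P)" by simp
  also have "\<dots> = inverse \<kappa> ^ N * P" using N by (simp add: \<kappa>_def)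
  also have "inverse \<kappa> ^ N = (8 * (real N)\<^sup>2) ^ N * r * r ^ m"
    by (simp add: \<kappa>_def power_mult_distrib N mult_ac)
  finally have "(2 * r) ^ m \<le> (8 * (real N)\<^sup>2) ^ N * r * r ^ m * P" .
  moreover have "r ^ m \<le> (2 * r) ^ m" using r by (intro power_mono) auto
  ultimately have "r ^ m * 1 \<le> r ^ m * ((8 * (real N)\<^sup>2) ^ N * r * P)" by (simp add: mult_ac)
  then have "1 \<le> (8 * (real N)\<^sup>2) ^ N * r * P" using r by (simp only: mult_le_cancel_left_pos zero_less_power)
  then have "inverse ((8 * (real N)\<^sup>2) ^ N * r) \<le> P"
    using r N by (simp add: field_simps)
  then show ?thesis using real by (simp add: ennreal_leI)
qed simp

section \<open>Oscillation on the surfaces of cubes\<close>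

definition cube_surface :: "'a::euclidean_space \<Rightarrow> real \<Rightarrow> 'a set" where
  "cube_surface c r = {x. (\<forall>j\<in>Basis. \<bar>(x - c) \<bullet> j\<bar> \<le> r) \<and> (\<exists>j\<in>Basis. \<bar>(x - c) \<bullet> j\<bar> = r)}"

lemma face_subset_cube_surface:
  "b \<in> Basis \<Longrightarrow> \<bar>\<sigma>\<bar> = 1 \<Longrightarrow> 0 < r \<Longrightarrow> face b (c \<bullet> b + \<sigma> * r) c r \<subseteq> cube_surface c r"
  by (force simp: face_def cube_surface_def inner_diff_left abs_mult)

lemma cube_surface_faceE:
  assumes "x \<in> cube_surface c r" "0 < r"
  obtains b \<sigma> where "b \<in> Basis" "\<sigma> \<in> {1, -1::real}" "x \<in> face b (c \<bullet> b + \<sigma> * r) c r"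
proof -
  obtain b where b: "b \<in> Basis" "\<bar>(x - c) \<bullet> b\<bar> = r" and
    le: "\<forall>j\<in>Basis. \<bar>(x - c) \<bullet> j\<bar> \<le> r" using assms by (auto simp: cube_surface_def)
  have "x \<in> face b (c \<bullet> b + sgn ((x - c) \<bullet> b) * r) c r"
    using b le assms(2) by (auto simp: face_def sgn_if inner_diff_left)
  moreover have "sgn ((x - c) \<bullet> b) \<in> {1, -1}" using b assms(2) by (auto simp: sgn_if)
  ultimately show ?thesis using that b by blast
qed

lemma convex_face: "convex (face b s c r)"
proof -
  have "face b s c r = {x. b \<bullet> x = s} \<inter> (\<Inter>j\<in>Basis - {b}. {x. j \<bullet> x \<le> r + c \<bullet> j} \<inter> {x. j \<bullet> x \<ge> c \<bullet> j - r})"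
    by (auto simp: face_def inner_diff_left inner_commute abs_le_iff algebra_simps)
  then show ?thesis
    by (auto intro!: convex_Int convex_INT convex_hyperplane convex_halfspace_le convex_halfspace_ge)
qed

text \<open>Two faces with different normals meet, and in dimension at least two opposite faces have a
  common neighbour.\<close>

lemma face_oscillation:
  fixes c :: "'a::euclidean_space" and u :: "'a \<Rightarrow> 'b::metric_space"
  assumes dim: "DIM('a) \<ge> 2" and r: "0 < r"
    and p: "p \<in> cube_surface c r" and q: "q \<in> cube_surface c r" and e: "0 < e" "e \<le> dist (u p) (u q)"
  obtains b \<sigma> p' q' where "b \<in> Basis" "\<sigma> \<in> {1, -1::real}" "p' \<in> face b (c \<bullet> b + \<sigma> * r) c r"
    "q' \<in> face b (c \<bullet> b + \<sigma> * r) c r" "e / 3 \<le> dist (u p') (u q')"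
proof -
  let ?good = "\<exists>b\<in>Basis. \<exists>\<sigma>\<in>{1,-1::real}. \<exists>p'\<in>face b (c \<bullet> b + \<sigma> * r) c r.
     \<exists>q'\<in>face b (c \<bullet> b + \<sigma> * r) c r. e / 3 \<le> dist (u p') (u q')"
  let ?f = "\<lambda>b \<sigma>. face b (c \<bullet> b + \<sigma> * r) c r"
  obtain b \<sigma> where b: "b \<in> Basis" "\<sigma> \<in> {1,-1}" "p \<in> ?f b \<sigma>" using cube_surface_faceE[OF p r] .
  obtain d \<tau> where d: "d \<in> Basis" "\<tau> \<in> {1,-1}" "q \<in> ?f d \<tau>" using cube_surface_faceE[OF q r] .
  have *: ?good
  proof (cases "b = d")
    case False
    \<comment> \<open>The centre of the ridge in which the two faces meet.\<close>
    define z where "z = slice b (c \<bullet> b + \<sigma> * r) (slice d (c \<bullet> d + \<tau> * r) c)"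
    have z: "z \<in> ?f b \<sigma>" "z \<in> ?f d \<tau>"
      using b d False r by (auto simp: z_def face_def slice_inner inner_diff_left)
    have "dist (u p) (u q) \<le> dist (u p) (u z) + dist (u z) (u q)" by (rule dist_triangle)
    then have "e / 3 \<le> dist (u p) (u z) \<or> e / 3 \<le> dist (u z) (u q)" using e by linarith
    then show ?thesis using b d z by blast
  next
    case bd: True
    have "\<exists>l\<in>Basis. l \<noteq> b"
    proof (rule ccontr)
      assume "\<not> ?thesis"
      then have "(Basis :: 'a set) \<subseteq> {b}" by auto
      then have "DIM('a) \<le> card {b}" by (intro card_mono) auto
      then show False using dim by simp
    qed
    then obtain l where l: "l \<in> Basis" "l \<noteq> b" by auto
    \<comment> \<open>Both points are pushed in direction \<open>l\<close> onto one adjacent face.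
      The detour from \<open>p\<close> over \<open>z\<close> and \<open>w\<close> to
      \<open>q\<close> then has three legs, each within a single face, whether the original faces
      are equal or opposite.\<close>
    define z where "z = slice l (c \<bullet> l + 1 * r) p"
    define w where "w = slice l (c \<bullet> l + 1 * r) q"
    have pc: "\<And>j. j \<in> Basis \<Longrightarrow> \<bar>(p - c) \<bullet> j\<bar> \<le> r" "\<And>j. j \<in> Basis \<Longrightarrow> \<bar>(q - c) \<bullet> j\<bar> \<le> r"
      using p q by (auto simp: cube_surface_def)
    have z: "z \<in> ?f b \<sigma>" "z \<in> ?f l 1" "w \<in> ?f b \<tau>" "w \<in> ?f l 1"
      using b d bd l r pc by (auto simp: z_def w_def face_def slice_inner inner_diff_left)
    have "dist (u p) (u q) \<le> dist (u p) (u z) + dist (u z) (u w) + dist (u w) (u q)"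
      by (meson dist_triangle dist_triangle_le add_mono order_trans order_refl)
    then have "e / 3 \<le> dist (u p) (u z) \<or> e / 3 \<le> dist (u z) (u w) \<or> e / 3 \<le> dist (u w) (u q)"
      using e by linarith
    then show ?thesis using b d bd z l by blast
  qed
  then show ?thesis using that by blast
qed

section \<open>Integration over the side length of the cubes\<close>

lemma nn_integral_inverse_Icc:
  assumes "0 < r1" "r1 \<le> r2"
  shows "(\<integral>\<^sup>+r. ennreal (inverse r) * indicator {r1..r2} r \<partial>lborel) = ennreal (ln (r2 / r1))"
proof -
  have "(\<integral>\<^sup>+r. ennreal (inverse r) * indicator {r1..r2} r \<partial>lborel) = ennreal (ln r2 - ln r1)"
    by (rule nn_integral_FTC_Icc) (use assms in \<open>auto intro!: DERIV_ln\<close>)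
  then show ?thesis using assms by (simp add: ln_div)
qed

text \<open>For each \<open>r\<close> some face carries an oscillation of at least
  \<open>e / 3\<close>, so every point of it differs by at least \<open>e / 6\<close> from one of
  two fixed points, and the hyperplane integral is at least a constant times \<open>1 / r\<close>.
  As the face depends on \<open>r\<close>, all \<open>2 * N\<close> faces are summed before
  integrating over \<open>r\<close>.\<close>

lemma ln_ratio_le_nn_integral_power:
  fixes c :: "'a::euclidean_space" and u :: "'a \<Rightarrow> 'b::metric_space"
  assumes dim: "DIM('a) \<ge> 2" and r12: "0 < r1" "r1 \<le> r2" and e: "0 < e"
    and \<rho>[measurable]: "\<rho> \<in> borel_measurable borel"
    and osc: "\<And>r. r1 \<le> r \<Longrightarrow> r \<le> r2 \<Longrightarrow>
        \<exists>p\<in>cube_surface c r. \<exists>q\<in>cube_surface c r. e \<le> dist (u p) (u q)"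
    and long: "\<And>r a z. r1 \<le> r \<Longrightarrow> r \<le> r2 \<Longrightarrow> closed_segment a z \<subseteq> cube_surface c r \<Longrightarrow>
        e / 6 \<le> dist (u a) (u z) \<Longrightarrow> 1 \<le> seg_int \<rho> a z"
  defines "N \<equiv> DIM('a)"
  shows "ennreal (inverse ((8 * (real N)\<^sup>2) ^ N) * ln (r2 / r1)) \<le> of_nat (2 * N) * (\<integral>\<^sup>+x. \<rho> x ^ N \<partial>lborel)"
proof -
  define K where "K = (8 * (real N)\<^sup>2) ^ N"
  have K: "K > 0" by (simp add: K_def N_def)
  let ?h = "\<lambda>x. \<rho> x ^ N"
  have pt: "ennreal (inverse (K * r)) \<le> (\<Sum>b\<in>Basis. \<Sum>\<sigma>\<in>{1,-1}. slice_int ?h b (c \<bullet> b + \<sigma> * r))"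
    if r: "r1 \<le> r" "r \<le> r2" for r
  proof -
    have r0: "0 < r" using r r12 by simp
    obtain p q where pq: "p\<in>cube_surface c r" "q\<in>cube_surface c r" "e \<le> dist (u p) (u q)"
      using osc[OF r] by auto
    obtain b \<sigma> p' q' where b: "b \<in> Basis" "\<sigma> \<in> {1, -1::real}" "p' \<in> face b (c \<bullet> b + \<sigma> * r) c r"
      "q' \<in> face b (c \<bullet> b + \<sigma> * r) c r" "e / 3 \<le> dist (u p') (u q')"
      using face_oscillation[OF dim r0 pq(1,2) e pq(3)] .
    have sub: "face b (c \<bullet> b + \<sigma> * r) c r \<subseteq> cube_surface c r"
      by (rule face_subset_cube_surface) (use b r0 in auto)
    have "ennreal (inverse (K * r)) \<le> slice_int ?h b (c \<bullet> b + \<sigma> * r)"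
      unfolding K_def N_def
    proof (rule slice_int_ge_of_seg_int[OF \<rho> b(1) r0 b(3,4)])
      fix z assume z: "z \<in> face b (c \<bullet> b + \<sigma> * r) c r"
      have "closed_segment p' z \<subseteq> cube_surface c r" "closed_segment q' z \<subseteq> cube_surface c r"
        using closed_segment_subset[OF _ z convex_face] b sub by blast+
      moreover have "e / 6 \<le> dist (u p') (u z) \<or> e / 6 \<le> dist (u q') (u z)"
        using dist_triangle2[of "u p'" "u q'" "u z"] b(5) by linarith
      ultimately show "1 \<le> seg_int \<rho> p' z \<or> 1 \<le> seg_int \<rho> q' z" using long[OF r] by blast
    qed
    also have "\<dots> \<le> (\<Sum>\<sigma>\<in>{1,-1}. slice_int ?h b (c \<bullet> b + \<sigma> * r))"
      by (rule member_le_sum[OF b(2)]) auto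
    also have "\<dots> \<le> (\<Sum>b\<in>Basis. \<Sum>\<sigma>\<in>{1,-1}. slice_int ?h b (c \<bullet> b + \<sigma> * r))"
      using b(1) by (rule member_le_sum) auto
    finally show ?thesis .
  qed
  have "ennreal (inverse K * ln (r2 / r1)) = ennreal (inverse K) * (\<integral>\<^sup>+r. ennreal (inverse r) * indicator {r1..r2} r \<partial>lborel)"
    using K r12 by (simp add: nn_integral_inverse_Icc ennreal_mult)
  also have "\<dots> = (\<integral>\<^sup>+r. ennreal (inverse K) * (ennreal (inverse r) * indicator {r1..r2} r) \<partial>lborel)"
    by (rule nn_integral_cmult[symmetric]) simp
  also have "\<dots> \<le> (\<integral>\<^sup>+r. (\<Sum>b\<in>Basis. \<Sum>\<sigma>\<in>{1,-1}. slice_int ?h b (c \<bullet> b + \<sigma> * r)) \<partial>lborel)"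
  proof (rule nn_integral_mono)
    fix r
    show "ennreal (inverse K) * (ennreal (inverse r) * indicator {r1..r2} r)
       \<le> (\<Sum>b\<in>Basis. \<Sum>\<sigma>\<in>{1,-1}. slice_int ?h b (c \<bullet> b + \<sigma> * r))"
      using pt[of r] K r12 by (cases "r \<in> {r1..r2}") (simp_all add: ennreal_mult)
  qed
  also have "\<dots> = (\<Sum>b\<in>Basis. \<Sum>\<sigma>\<in>{1,-1}. \<integral>\<^sup>+r. slice_int ?h b (c \<bullet> b + \<sigma> * r) \<partial>lborel)"
    by (simp add: nn_integral_sum nn_integral_add)
  \<comment> \<open>For each choice of \<open>b\<close> and \<open>\<sigma>\<close> the map
    \<open>r \<mapsto> c \<bullet> b + \<sigma> * r\<close> preserves Lebesgue measure on the line,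
    so by Fubini every family of parallel slices recovers the full integral.\<close>
  also have "\<dots> = (\<Sum>b\<in>(Basis::'a set). \<Sum>\<sigma>\<in>{1,-1::real}. \<integral>\<^sup>+x. ?h x \<partial>lborel)"
  proof (intro sum.cong refl)
    fix b :: 'a and \<sigma> :: real assume b: "b \<in> Basis" and \<sigma>: "\<sigma> \<in> {1, -1}"
    have "(\<integral>\<^sup>+s. slice_int ?h b s \<partial>lborel) = ennreal \<bar>\<sigma>\<bar> * (\<integral>\<^sup>+r. slice_int ?h b (c \<bullet> b + \<sigma> * r) \<partial>lborel)"
      by (rule nn_integral_real_affine) (use \<sigma> in auto)
    moreover have "\<bar>\<sigma>\<bar> = 1" using \<sigma> by auto
    ultimately show "(\<integral>\<^sup>+r. slice_int ?h b (c \<bullet> b + \<sigma> * r) \<partial>lborel) = (\<integral>\<^sup>+x. ?h x \<partial>lborel)"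
      using nn_integral_slice_int[of ?h b] b by simp
  qed
  also have "\<dots> = of_nat (2 * N) * (\<integral>\<^sup>+x. ?h x \<partial>lborel)"
    by (simp add: N_def mult_2 mult_2_right distrib_left distrib_right)
  finally show ?thesis unfolding K_def .
qed

text \<open>Prolonging the segment from \<open>x\<close> to \<open>y\<close> beyond both ends until
  it meets the frontier can only increase the distance. If the points coincide, any frontier point
  will do, as a nonempty compact set is not the whole space.\<close>

lemma exists_frontier_pair:
  fixes S :: "'a::euclidean_space set"
  assumes S: "compact S" and x: "x \<in> S" and y: "y \<in> S"
  obtains p q where "p \<in> frontier S" "q \<in> frontier S" "dist x y \<le> dist p q"
proof (cases "x = y")
  case True
  obtain p where "p \<in> frontier S"
    using S x frontier_eq_empty[of S] compact_imp_bounded not_bounded_UNIV by blast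
  then show ?thesis using that[of p p] True by simp
next
  case False
  define e where "e = sgn (y - x)"
  have e: "norm e = 1" using False by (simp add: e_def norm_sgn)
  have ex: "\<exists>s\<ge>0. a + s *\<^sub>R v \<in> frontier S" if a: "a \<in> S" and v: "norm v = 1" for a v
  proof -
    have bS: "bounded S" using S by (rule compact_imp_bounded)
    then obtain R where R: "\<And>z. z \<in> S \<Longrightarrow> norm z \<le> R" unfolding bounded_iff by blast
    \<comment> \<open>A point on the ray so far from \<open>a\<close> that its norm exceeds the
      bound \<open>R\<close> of \<open>S\<close>.\<close>
    define b where "b = a + (R + norm a + 1) *\<^sub>R v"
    have R0: "0 \<le> R" using R[OF a] norm_ge_zero order_trans by blast
    have "norm ((R + norm a + 1) *\<^sub>R v) \<le> norm b + norm a"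
      using norm_triangle_ineq4[of b a] by (simp add: b_def)
    then have "norm b > R" using v R0 by simp
    then have "b \<notin> S" using R by fastforce
    then have "closed_segment a b \<inter> frontier S \<noteq> {}"
      using a by (intro connected_Int_frontier) auto
    then obtain z where z: "z \<in> frontier S" "z \<in> closed_segment a b" by auto
    then obtain t where t: "0 \<le> t" "z = a + t *\<^sub>R (b - a)"
      by (auto simp: closed_segment_def algebra_simps)
    then have "z = a + (t * (R + norm a + 1)) *\<^sub>R v" by (simp add: b_def)
    then show ?thesis using z(1) t R0 by (intro exI[of _ "t * (R + norm a + 1)"]) auto
  qed
  obtain s where s: "s \<ge> 0" "y + s *\<^sub>R e \<in> frontier S" using ex[OF y e] by auto
  obtain t where t: "t \<ge> 0" "x + t *\<^sub>R (- e) \<in> frontier S" using ex[OF x, of "- e"] e by auto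
  have yx: "y - x = norm (y - x) *\<^sub>R e" using False by (simp add: e_def sgn_div_norm)
  have "(y + s *\<^sub>R e) - (x + t *\<^sub>R (- e)) = (norm (y - x) + s + t) *\<^sub>R e"
    using yx by (simp add: algebra_simps)
  then have "dist (y + s *\<^sub>R e) (x + t *\<^sub>R (- e)) = norm (y - x) + s + t"
    unfolding dist_norm using e s(1) t(1) by simp
  then have "dist x y \<le> dist (x + t *\<^sub>R (- e)) (y + s *\<^sub>R e)"
    using s(1) t(1) by (simp only: dist_commute[of x] dist_commute[of "x + _"] dist_norm[of y x])
  then show ?thesis using that s t by blast
qed

section \<open>Line integrals along segments\<close>

text \<open>Along a sorted list the chord lengths telescope, and the list \<open>[s, e]\<close>
  attains the bound.\<close>

lemma path_len_affine:
  fixes a v :: "'a::real_normed_vector"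
  assumes \<gamma>: "\<And>t. t \<in> {s..e} \<Longrightarrow> \<gamma> t = a + t *\<^sub>R v" and se: "s \<le> e"
  shows "path_len \<gamma> s e = ennreal ((e - s) * norm v)"
proof (rule antisym)
  show "path_len \<gamma> s e \<le> ennreal ((e - s) * norm v)"
    unfolding path_len_def
  proof (rule SUP_least, clarify)
    fix ts :: "real list" assume ts: "sorted ts" "set ts \<subseteq> {s..e}"
    have "(\<Sum>i<length ts - 1. dist (\<gamma> (ts ! i)) (\<gamma> (ts ! Suc i)))
        = (\<Sum>i<length ts - 1. ts ! Suc i * norm v - ts ! i * norm v)"
    proof (rule sum.cong[OF refl])
      fix i assume "i \<in> {..<length ts - 1}"
      then have i: "Suc i < length ts" by auto
      then have "ts ! i \<in> {s..e}" "ts ! Suc i \<in> {s..e}" using ts(2) by (meson Suc_lessD nth_mem subsetD)+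
      moreover have "ts ! i \<le> ts ! Suc i" using sorted_nth_mono[OF ts(1), of i "Suc i"] i by simp
      ultimately show "dist (\<gamma> (ts ! i)) (\<gamma> (ts ! Suc i)) = ts ! Suc i * norm v - ts ! i * norm v"
        by (simp add: \<gamma> dist_norm abs_minus_commute flip: scaleR_diff_left left_diff_distrib)
    qed
    also have "\<dots> = ts ! (length ts - 1) * norm v - ts ! 0 * norm v" by (rule sum_lessThan_telescope)
    also have "\<dots> \<le> (e - s) * norm v"
    \<comment> \<open>For the empty list \<open>length ts - 1\<close> is 0 by truncated subtraction,
      so the two terms cancel whatever \<open>ts ! 0\<close> is.\<close>
    proof (cases "ts = []")
      case False
      then have "ts ! (length ts - 1) \<in> {s..e}" "ts ! 0 \<in> {s..e}" using ts(2) by (simp_all add: subset_eq)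
      then have "ts ! (length ts - 1) - ts ! 0 \<le> e - s" by simp
      then show ?thesis by (simp flip: left_diff_distrib add: mult_right_mono)
    qed (use se in simp)
    finally show "ennreal (\<Sum>i<length ts - 1. dist (\<gamma> (ts ! i)) (\<gamma> (ts ! Suc i))) \<le> ennreal ((e - s) * norm v)"
      by (rule ennreal_leI)
  qed
  have "(e - s) * norm v = (\<Sum>i<length [s, e] - 1. dist (\<gamma> ([s, e] ! i)) (\<gamma> ([s, e] ! Suc i)))"
    using se by (simp add: \<gamma> dist_norm norm_minus_commute flip: scaleR_diff_left)
  also have "ennreal \<dots> \<le> path_len \<gamma> s e"
    unfolding path_len_def by (rule SUP_upper) (use se in auto)
  finally show "ennreal ((e - s) * norm v) \<le> path_len \<gamma> s e" .
qed

text \<open>For \<open>v \<noteq> 0\<close> arc length is an injective affine function of the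
  parameter, so \<open>inv_into\<close> is its true inverse and a linear substitution finishes. For
  \<open>v = 0\<close> the arc-length interval is a single point, hence a null set.\<close>

lemma line_integral_closed_affine:
  fixes a v :: "'a::euclidean_space"
  assumes \<gamma>: "\<And>t. t \<in> {s..e} \<Longrightarrow> \<gamma> t = a + t *\<^sub>R v" and se: "s \<le> e"
    and [measurable]: "\<rho> \<in> borel_measurable borel"
  shows "line_integral_closed \<rho> \<gamma> s e
      = ennreal (norm v) * (\<integral>\<^sup>+t. \<rho> (a + t *\<^sub>R v) * indicator {s..e} t \<partial>lborel)"
proof (cases "v = 0")
  case True
  have "(\<integral>\<^sup>+u. \<rho> (arc_param \<gamma> s e u) * indicator {0..0::real} u \<partial>lborel) = (\<integral>\<^sup>+u. 0 \<partial>(lborel::real measure))"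
    by (rule nn_integral_cong_AE, use AE_lborel_singleton[of 0] in eventually_elim) auto
  then show ?thesis using path_len_affine[OF \<gamma> se] True by (simp add: line_integral_closed_def)
next
  case False
  define L where "L = norm v"
  have L: "L > 0" using False by (simp add: L_def)
  have len: "enn2real (path_len \<gamma> s t) = (t - s) * L" if "t \<in> {s..e}" for t
    using path_len_affine[of s t \<gamma> a v] \<gamma> that by (simp add: L_def)
  have arc: "arc_param \<gamma> s e u = a + (s + u / L) *\<^sub>R v" if "u \<in> {0..(e - s) * L}" for u
  proof -
    have t: "s + u / L \<in> {s..e}" using that L by (simp add: field_simps)
    have "inv_into {s..e} (\<lambda>t. enn2real (path_len \<gamma> s t)) u = s + u / L"
    proof (rule inv_into_f_eq)
      show "inj_on (\<lambda>t. enn2real (path_len \<gamma> s t)) {s..e}"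
        using L by (auto simp: inj_on_def len)
    qed (use t len[OF t] L in auto)
    then show ?thesis using \<gamma>[OF t] by (simp add: arc_param_def)
  qed
  let ?f = "\<lambda>u. \<rho> (a + (s + u / L) *\<^sub>R v) * indicator {0..(e - s) * L} u"
  have "line_integral_closed \<rho> \<gamma> s e = (\<integral>\<^sup>+u. ?f u \<partial>lborel)"
    unfolding line_integral_closed_def using len[of e] se
    by (auto intro!: nn_integral_cong simp: arc split: split_indicator)
  also have "\<dots> = ennreal \<bar>L\<bar> * (\<integral>\<^sup>+t. ?f (- s * L + L * t) \<partial>lborel)"
    by (rule nn_integral_real_affine) (use L in auto)
  also have "(\<lambda>t. ?f (- s * L + L * t)) = (\<lambda>t. \<rho> (a + t *\<^sub>R v) * indicator {s..e} t)"
  proof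
    fix t
    have "s + (- s * L + L * t) / L = t" using L by (simp add: field_simps)
    moreover have "- s * L + L * t \<in> {0..(e - s) * L} \<longleftrightarrow> t \<in> {s..e}"
    proof -
      have "- s * L + L * t = (t - s) * L" by (simp add: algebra_simps)
      then show ?thesis using L by (auto simp: zero_le_mult_iff)
    qed
    ultimately show "?f (- s * L + L * t) = \<rho> (a + t *\<^sub>R v) * indicator {s..e} t"
      by (simp add: indicator_def)
  qed
  finally show ?thesis using L by (simp add: L_def)
qed

lemma locally_rectifiable_affine:
  fixes a v :: "'a::real_normed_vector"
  assumes "\<And>t. t \<in> {0..1} \<Longrightarrow> \<gamma> t = a + t *\<^sub>R v"
  shows "locally_rectifiable {0..1} \<gamma>"
  unfolding locally_rectifiable_def
proof (intro ballI impI)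
  fix s e :: real assume "s \<in> {0..1}" "e \<in> {0..1}" "s \<le> e"
  then show "path_len \<gamma> s e < \<infinity>" using path_len_affine[of s e \<gamma> a v] assms by simp
qed

lemma line_integral_affine_le:
  fixes a v :: "'a::euclidean_space"
  assumes \<gamma>: "\<And>t. t \<in> {0..1} \<Longrightarrow> \<gamma> t = a + t *\<^sub>R v"
    and \<rho>: "\<rho> \<in> borel_measurable borel"
  shows "line_integral \<rho> {0..1} \<gamma> \<le> seg_int \<rho> a (a + v)"
  unfolding line_integral_def seg_int_def
proof (rule SUP_least, clarify)
  fix s e :: real assume se: "s \<in> {0..1}" "e \<in> {0..1}" "s \<le> e"
  show "line_integral_closed \<rho> \<gamma> s e \<le> ennreal (norm (a + v - a)) *
     (\<integral>\<^sup>+t. \<rho> (a + t *\<^sub>R (a + v - a)) * indicator {0..1} t \<partial>lborel)"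
    using se by (subst line_integral_closed_affine[OF \<gamma> _ \<rho>])
      (auto intro!: mult_left_mono nn_integral_mono simp: indicator_def)
qed

lemma seg_int_subsegment_le:
  fixes a v :: "'a::euclidean_space"
  assumes [measurable]: "\<rho> \<in> borel_measurable borel" and t: "0 \<le> t1" "t1 \<le> t2" "t2 \<le> 1"
  shows "seg_int \<rho> (a + t1 *\<^sub>R (b - a)) (a + t2 *\<^sub>R (b - a)) \<le> seg_int \<rho> a b"
proof (cases "t1 = t2")
  case False
  define v where "v = b - a"
  define c where "c = t2 - t1"
  have c: "c > 0" using False t by (simp add: c_def)
  let ?f = "\<lambda>u. \<rho> (a + u *\<^sub>R v) * indicator {t1..t2} u"
  have d: "(a + t2 *\<^sub>R v) - (a + t1 *\<^sub>R v) = c *\<^sub>R v" by (simp add: c_def algebra_simps)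
  have "seg_int \<rho> (a + t1 *\<^sub>R v) (a + t2 *\<^sub>R v)
      = ennreal (norm v) * (ennreal \<bar>c\<bar> * (\<integral>\<^sup>+t. \<rho> (a + t1 *\<^sub>R v + t *\<^sub>R (c *\<^sub>R v)) * indicator {0..1} t \<partial>lborel))"
    unfolding seg_int_def d using c by (simp add: ennreal_mult mult_ac)
  also have "(\<lambda>t. \<rho> (a + t1 *\<^sub>R v + t *\<^sub>R (c *\<^sub>R v)) * indicator {0..1} t) = (\<lambda>t. ?f (t1 + c * t))"
  proof
    fix t
    have eq: "a + t1 *\<^sub>R v + t *\<^sub>R (c *\<^sub>R v) = a + (t1 + c * t) *\<^sub>R v" by (simp add: algebra_simps)
    have "t1 + c * t \<in> {t1..t2} \<longleftrightarrow> t \<in> {0..1}"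
    proof -
      have "t2 = t1 + c * 1" by (simp add: c_def)
      then show ?thesis using c by (simp add: zero_le_mult_iff mult_le_cancel_left1)
    qed
    then show "\<rho> (a + t1 *\<^sub>R v + t *\<^sub>R (c *\<^sub>R v)) * indicator {0..1} t = ?f (t1 + c * t)"
      unfolding eq indicator_def by simp
  qed
  also have "ennreal \<bar>c\<bar> * (\<integral>\<^sup>+t. ?f (t1 + c * t) \<partial>lborel) = (\<integral>\<^sup>+u. ?f u \<partial>lborel)"
    by (rule nn_integral_real_affine[symmetric]) (use c in auto)
  also have "ennreal (norm v) * \<dots> \<le> seg_int \<rho> a b"
    unfolding seg_int_def v_def using t by (auto intro!: mult_left_mono nn_integral_mono simp: indicator_def)
  finally show ?thesis by (simp add: v_def)
qed (simp add: seg_int_def)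

section \<open>Segments in \<open>D'\<close> and the ring paths obtained from them\<close>

lemma topspace_subtopology_Rbar: "topspace (subtopology (Rbar :: (real ^ 'n) option topology) S) = S"
  by (simp add: UNIV_option_conv[symmetric])

lemma continuous_on_homeo_Some:
  fixes D :: "(real ^ 'n) set" and D' :: "(real ^ 'n) option set"
  assumes g: "homeomorphic_map (subtopology Rbar D') (top_of_set D) g"
    and \<sigma>: "continuous_on T \<sigma>" and sub: "Some ` \<sigma> ` T \<subseteq> D'"
  shows "continuous_on T (\<lambda>t. g (Some (\<sigma> t)))"
proof -
  have "continuous_map (top_of_set T) euclidean \<sigma>" using \<sigma> by simp
  then have "continuous_map (top_of_set T) Rbar (Some \<circ> \<sigma>)"
    by (rule continuous_map_compose[OF _ continuous_map_Some])
  then have "continuous_map (top_of_set T) (subtopology Rbar D') (Some \<circ> \<sigma>)"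
    using sub by (auto simp: continuous_map_in_subtopology)
  then have "continuous_map (top_of_set T) (top_of_set D) (g \<circ> (Some \<circ> \<sigma>))"
    by (rule continuous_map_compose[OF _ homeomorphic_imp_continuous_map[OF g]])
  then show ?thesis by (simp add: continuous_map_in_subtopology o_def)
qed

text \<open>The \<open>g\<close>-image of the segment starts within distance \<open>r1\<close> of
  \<open>z\<close> and ends at distance at least \<open>r2\<close>, so the image of a subsegment
  joins the two spheres inside \<open>D\<close>. Its image under the inverse of \<open>g\<close> is
  that subsegment itself, to which admissibility applies.\<close>

lemma seg_int_ge_1_of_admissible:
  fixes D :: "(real ^ 'n) set" and D' :: "(real ^ 'n) option set"
  assumes g: "homeomorphic_map (subtopology Rbar D') (top_of_set D) g"
    and \<rho>: "\<rho> \<in> admissible (image_family (inv_into D' g) D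
              (joining_paths (Some ` sphere z r1) (Some ` sphere z r2) (Some ` D)))"
    and sub: "Some ` closed_segment a b \<subseteq> D'" and r: "r1 \<le> r2"
    and a: "dist z (g (Some a)) \<le> r1" and b: "r2 \<le> dist z (g (Some b))"
  shows "1 \<le> seg_int \<rho> a b"
proof -
  have gD: "g ` D' = D" "inj_on g D'"
    using homeomorphic_imp_surjective_map[OF g] homeomorphic_imp_injective_map[OF g]
    unfolding topspace_subtopology_Rbar by simp_all
  define \<sigma> where "\<sigma> t = a + t *\<^sub>R (b - a)" for t :: real
  have \<sigma>: "Some (\<sigma> t) \<in> D'" if "t \<in> {0..1}" for t
  proof -
    have "\<sigma> t = (1 - t) *\<^sub>R a + t *\<^sub>R b" by (simp add: \<sigma>_def algebra_simps)
    then have "\<sigma> t \<in> closed_segment a b" using that by (auto simp: in_segment)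
    then show ?thesis using sub by auto
  qed
  have c: "continuous_on {0..1} (\<lambda>t. g (Some (\<sigma> t)))"
    by (rule continuous_on_homeo_Some[OF g]) (use \<sigma> in \<open>auto simp: \<sigma>_def intro!: continuous_intros\<close>)
  let ?\<phi> = "\<lambda>t. dist z (g (Some (\<sigma> t)))"
  have c\<phi>: "continuous_on {0..1} ?\<phi>" using c by (intro continuous_intros)
  have e: "\<sigma> 0 = a" "\<sigma> 1 = b" by (auto simp: \<sigma>_def)
  \<comment> \<open>The second parameter is sought only after the first, so that the subsegment is
    traversed from the inner to the outer sphere.\<close>
  obtain t1 where t1: "0 \<le> t1" "t1 \<le> 1" "?\<phi> t1 = r1"
    using IVT'[of ?\<phi> 0 r1 1] a b r c\<phi> e by auto
  have c1: "continuous_on {t1..1} ?\<phi>" using c\<phi> by (rule continuous_on_subset) (use t1 in auto)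
  obtain t2 where t2: "t1 \<le> t2" "t2 \<le> 1" "?\<phi> t2 = r2"
    using IVT'[of ?\<phi> t1 r2 1] b r t1 c1 e by auto
  define \<tau> where "\<tau> t = t1 + t * (t2 - t1)" for t
  have \<tau>: "\<tau> t \<in> {0..1}" if "t \<in> {0..1}" for t
  proof -
    have "t * (t2 - t1) \<le> 1 * (t2 - t1)" using that t2 by (intro mult_right_mono) auto
    then show ?thesis using that t1 t2 by (auto simp: \<tau>_def)
  qed
  define k where "k t = g (Some (\<sigma> (\<tau> t)))" for t
  define \<gamma> where "\<gamma> t = Some (k t)" for t
  have kD: "k t \<in> D" if "t \<in> {0..1}" for t using \<sigma>[OF \<tau>[OF that]] gD by (auto simp: k_def)
  have "continuous_on {0..1} k" unfolding k_def
    by (rule continuous_on_homeo_Some[OF g]) (use \<sigma> \<tau> in \<open>auto simp: \<sigma>_def \<tau>_def intro!: continuous_intros\<close>)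
  then have "continuous_map (top_of_set {0..1}) Rbar (Some \<circ> k)"
    by (intro continuous_map_compose[OF _ continuous_map_Some]) simp
  moreover have "k 0 \<in> sphere z r1" "k 1 \<in> sphere z r2"
    using t1 t2 by (auto simp: k_def \<tau>_def)
  ultimately have "\<gamma> \<in> joining_paths (Some ` sphere z r1) (Some ` sphere z r2) (Some ` D)"
    using kD by (auto simp: joining_paths_def \<gamma>_def[abs_def] o_def)
  then have "({t \<in> {0..1}. \<gamma> t \<in> Some ` D}, inv_into D' g \<circ> the \<circ> \<gamma>) \<in> image_family (inv_into D' g) D
              (joining_paths (Some ` sphere z r1) (Some ` sphere z r2) (Some ` D))"
    unfolding image_family_def by (rule imageI)
  \<comment> \<open>The end points also lie in \<open>D\<close>, so the natural domain of the image
    path is the full closed interval.\<close>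
  moreover have "{t \<in> {0..1}. \<gamma> t \<in> Some ` D} = {0..1}" using kD by (auto simp: \<gamma>_def)
  ultimately have mem: "({0..1}, inv_into D' g \<circ> the \<circ> \<gamma>) \<in> image_family (inv_into D' g) D
              (joining_paths (Some ` sphere z r1) (Some ` sphere z r2) (Some ` D))" by simp
  have f\<gamma>: "(inv_into D' g \<circ> the \<circ> \<gamma>) t = Some (\<sigma> (\<tau> t))" if "t \<in> {0..1}" for t
    using \<sigma>[OF \<tau>[OF that]] gD(2) by (simp add: \<gamma>_def k_def)
  have aff: "(the \<circ> (inv_into D' g \<circ> the \<circ> \<gamma>)) t = \<sigma> t1 + t *\<^sub>R (\<sigma> t2 - \<sigma> t1)" if "t \<in> {0..1}" for t
    using f\<gamma>[OF that] by (simp add: \<sigma>_def \<tau>_def algebra_simps)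
  have \<rho>m: "\<rho> \<in> borel_measurable borel" using \<rho> by (auto simp: admissible_def)
  have "None \<notin> (inv_into D' g \<circ> the \<circ> \<gamma>) ` {0..1}" using f\<gamma> by auto
  then have "1 \<le> line_integral \<rho> {0..1} (the \<circ> (inv_into D' g \<circ> the \<circ> \<gamma>))"
    using \<rho> mem locally_rectifiable_affine[OF aff] unfolding admissible_def by fast
  also have "\<dots> \<le> seg_int \<rho> (\<sigma> t1) (\<sigma> t1 + (\<sigma> t2 - \<sigma> t1))"
    by (rule line_integral_affine_le[OF aff \<rho>m])
  also have "\<dots> \<le> seg_int \<rho> a b"
    using seg_int_subsegment_le[OF \<rho>m, of t1 t2 a b] t1 t2 by (simp add: \<sigma>_def)
  finally show ?thesis .
qed

section \<open>Densities for ring \<open>Q\<close>-homeomorphisms\<close>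

text \<open>If no point of \<open>D\<close> is farther than \<open>e / 2\<close> from
  \<open>z\<close>, the condition is vacuous and the zero density works. Otherwise the ring
  inequality bounds the modulus by \<open>C - 1\<close>; the added 1 leaves room for a density close
  to the infimum.\<close>

lemma ring_density:
  fixes D :: "(real ^ 'n) set" and D' :: "(real ^ 'n) option set"
  assumes g: "g \<in> ring_family Q D D'" and e: "0 < e" and z: "z \<in> D"
    and D: "open D" and Qm[measurable]: "Q \<in> borel_measurable lebesgue"
    and Q: "(\<integral>\<^sup>+ x \<in> D. Q x \<partial>lebesgue) < \<infinity>"
  defines "C \<equiv> ennreal ((4 / e) ^ CARD('n)) * (\<integral>\<^sup>+ x \<in> D. Q x \<partial>lebesgue) + 1"
  shows "\<exists>\<rho>\<in>borel_measurable borel. (\<integral>\<^sup>+x. \<rho> x ^ CARD('n) \<partial>lborel) \<le> C \<and>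
     (\<forall>a b. Some ` closed_segment a b \<subseteq> D' \<longrightarrow> dist z (g (Some a)) \<le> e / 4 \<longrightarrow>
        e / 2 < dist z (g (Some b)) \<longrightarrow> 1 \<le> seg_int \<rho> a b)"
proof -
  let ?f = "inv_into D' g"
  have hom: "homeomorphic_map (subtopology Rbar D') (top_of_set D) g"
    and ring: "ring_Q_mapping_at Q D ?f z"
    using g z by (auto simp: ring_family_def ring_Q_homeomorphism_def ring_Q_mapping_def)
  have gD: "g ` D' = D" using homeomorphic_imp_surjective_map[OF hom]
    unfolding topspace_subtopology_Rbar by simp
  show ?thesis
  proof (cases "ereal (e / 2) < (SUP x\<in>D. ereal (norm (x - z)))")
    case False
    have "\<not> e / 2 < dist z (g (Some b))" if "Some ` closed_segment a b \<subseteq> D'" for a b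
    proof
      assume "e / 2 < dist z (g (Some b))"
      moreover have "g (Some b) \<in> D" using that gD by auto
      ultimately have "ereal (e / 2) < (SUP x\<in>D. ereal (norm (x - z)))"
        unfolding less_SUP_iff by (intro bexI[of _ "g (Some b)"]) (auto simp: dist_norm norm_minus_commute)
      with False show False ..
    qed
    then show ?thesis by (intro bexI[of _ "\<lambda>_. 0"]) (auto simp: zero_power)
  next
    case True
    let ?\<Gamma> = "image_family ?f D (joining_paths (Some ` sphere z (e / 4)) (Some ` sphere z (e / 2)) (Some ` D))"
    \<comment> \<open>The interval from \<open>e / 4\<close> to \<open>e / 2\<close> has length
      \<open>e / 4\<close>, so this constant has integral 1.\<close>
    let ?\<eta> = "\<lambda>_::real. ennreal (4 / e)"
    have I: "(\<integral>\<^sup>+ r \<in> {e/4<..<e/2}. ?\<eta> r \<partial>lebesgue) \<ge> 1"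
    proof -
      have "(\<integral>\<^sup>+ r \<in> {e/4<..<e/2}. ?\<eta> r \<partial>lebesgue) = ennreal (4 / e) * ennreal (e / 4)"
        using e by (simp add: nn_integral_cmult_indicator)
      then show ?thesis using e by (simp add: ennreal_mult[symmetric])
    qed
    have "modulus ?\<Gamma> \<le> (\<integral>\<^sup>+ x \<in> {x. e/4 < norm (x - z) \<and> norm (x - z) < e/2} \<inter> D.
              Q x * ?\<eta> (norm (x - z)) ^ CARD('n) \<partial>lebesgue)"
      using ring[unfolded ring_Q_mapping_at_def, rule_format, of "e/4" "e/2" ?\<eta>] True I e by auto
    also have "\<dots> \<le> (\<integral>\<^sup>+ x. ennreal ((4 / e) ^ CARD('n)) * (Q x * indicator D x) \<partial>lebesgue)"
      using e by (intro nn_integral_mono) (auto simp: indicator_def ennreal_power mult.commute)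
    also have "\<dots> = ennreal ((4 / e) ^ CARD('n)) * (\<integral>\<^sup>+ x \<in> D. Q x \<partial>lebesgue)"
    proof (rule nn_integral_cmult)
      have "D \<in> sets lebesgue" using D by auto
      then show "(\<lambda>x. Q x * indicator D x) \<in> borel_measurable lebesgue" by measurable
    qed
    \<comment> \<open>Integrability of \<open>Q\<close> enters here: only a finite number is
      strictly smaller than itself plus 1.\<close>
    also have "\<dots> < C"
    proof -
      have "ennreal ((4 / e) ^ CARD('n)) * (\<integral>\<^sup>+ x \<in> D. Q x \<partial>lebesgue) < \<infinity>"
        using Q by (simp add: ennreal_mult_less_top)
      then obtain X where "ennreal ((4 / e) ^ CARD('n)) * (\<integral>\<^sup>+ x \<in> D. Q x \<partial>lebesgue) = ennreal X" "0 \<le> X"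
        unfolding infinity_ennreal_def less_top_ennreal by blast
      moreover have "ennreal X < ennreal (X + 1)" "ennreal (X + 1) = ennreal X + 1"
        using \<open>0 \<le> X\<close> by (simp_all add: ennreal_less_iff ennreal_plus)
      ultimately show ?thesis unfolding C_def by simp
    qed
    finally obtain \<rho> where \<rho>: "\<rho> \<in> admissible ?\<Gamma>" "(\<integral>\<^sup>+ x. \<rho> x ^ CARD('n) \<partial>lebesgue) < C"
      unfolding modulus_def INF_less_iff by auto
    have "\<rho> \<in> borel_measurable borel" using \<rho> by (auto simp: admissible_def)
    moreover have "1 \<le> seg_int \<rho> a b" if "Some ` closed_segment a b \<subseteq> D'"
      "dist z (g (Some a)) \<le> e / 4" "e / 2 < dist z (g (Some b))" for a b
      using seg_int_ge_1_of_admissible[OF hom \<rho>(1) that(1) _ that(2)] that(3) e by simp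
    ultimately show ?thesis using \<rho>(2) by (intro bexI[of _ \<rho>]) (auto simp: nn_integral_completion)
  qed
qed

text \<open>Finitely many balls of radius \<open>e / 4\<close> cover \<open>D\<close>. The densities
  of the corresponding rings are combined by a pointwise maximum, whose power is at most the sum of
  the powers. If \<open>g (Some a)\<close> is in the ball around \<open>z\<close>, then
  \<open>g (Some b)\<close> is at distance more than \<open>e / 2\<close> from \<open>z\<close>, so
  the ring around \<open>z\<close> is crossed.\<close>

lemma ring_family_density:
  fixes D :: "(real ^ 'n) set" and D' :: "(real ^ 'n) option set"
  assumes D: "open D" "bounded D" "D \<noteq> {}" and e: "0 < e"
    and Qm: "Q \<in> borel_measurable lebesgue"
    and Q: "(\<integral>\<^sup>+ x \<in> D. Q x \<partial>lebesgue) < \<infinity>"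
  obtains C where "C < \<infinity>" "\<And>g. g \<in> ring_family Q D D' \<Longrightarrow>
     \<exists>\<rho>\<in>borel_measurable borel. (\<integral>\<^sup>+x. \<rho> x ^ CARD('n) \<partial>lborel) \<le> C \<and>
     (\<forall>a b. Some ` closed_segment a b \<subseteq> D' \<longrightarrow> e \<le> dist (g (Some a)) (g (Some b)) \<longrightarrow> 1 \<le> seg_int \<rho> a b)"
proof -
  define C0 where "C0 = ennreal ((4 / e) ^ CARD('n)) * (\<integral>\<^sup>+ x \<in> D. Q x \<partial>lebesgue) + 1"
  have C0: "C0 < \<infinity>" using Q by (auto simp: C0_def ennreal_mult_less_top)
  have comp: "compact (closure D)" using D(2) by (simp add: compact_closure)
  have cov: "closure D \<subseteq> (\<Union>z\<in>D. ball z (e / 4))"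
  proof
    fix x assume "x \<in> closure D"
    then have "\<forall>d>0. \<exists>z\<in>D. dist z x < d" by (simp add: closure_approachable)
    moreover have "e / 4 > 0" using e by simp
    ultimately obtain z where "z \<in> D" "dist z x < e / 4" by blast
    then show "x \<in> (\<Union>z\<in>D. ball z (e / 4))" by auto
  qed
  \<comment> \<open>The net is fixed before \<open>g\<close>, which makes the bound uniform over the
    family.\<close>
  obtain Z where Z: "Z \<subseteq> D" "finite Z" "closure D \<subseteq> (\<Union>z\<in>Z. ball z (e / 4))"
    by (rule compactE_image[OF comp _ cov]) auto
  then have ZD: "D \<subseteq> (\<Union>z\<in>Z. ball z (e / 4))" using closure_subset by blast
  have Zne: "Z \<noteq> {}" using ZD D(3) by auto
  show ?thesis
  proof (rule that[of "of_nat (card Z) * C0"])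
    show "of_nat (card Z) * C0 < \<infinity>"
      using C0 by (simp add: ennreal_mult_less_top ennreal_of_nat_eq_real_of_nat)
    fix g assume g: "g \<in> ring_family Q D D'"
    have gD: "g ` D' = D" using g homeomorphic_imp_surjective_map[of "subtopology Rbar D'" "top_of_set D" g]
      unfolding topspace_subtopology_Rbar by (simp add: ring_family_def)
    have "\<forall>z\<in>Z. \<exists>\<rho>\<in>borel_measurable borel. (\<integral>\<^sup>+x. \<rho> x ^ CARD('n) \<partial>lborel) \<le> C0 \<and>
     (\<forall>a b. Some ` closed_segment a b \<subseteq> D' \<longrightarrow> dist z (g (Some a)) \<le> e / 4 \<longrightarrow>
        e / 2 < dist z (g (Some b)) \<longrightarrow> 1 \<le> seg_int \<rho> a b)"
      unfolding C0_def by (intro ballI ring_density[OF g e _ D(1) Qm Q]) (use Z(1) in auto)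
    then obtain R where R: "\<And>z. z \<in> Z \<Longrightarrow> R z \<in> borel_measurable borel"
      "\<And>z. z \<in> Z \<Longrightarrow> (\<integral>\<^sup>+x. R z x ^ CARD('n) \<partial>lborel) \<le> C0"
      "\<And>z a b. z \<in> Z \<Longrightarrow> Some ` closed_segment a b \<subseteq> D' \<Longrightarrow> dist z (g (Some a)) \<le> e / 4 \<Longrightarrow>
        e / 2 < dist z (g (Some b)) \<Longrightarrow> 1 \<le> seg_int (R z) a b"
      by metis
    define \<rho> where "\<rho> x = (SUP z\<in>Z. R z x)" for x
    have [measurable]: "\<rho> \<in> borel_measurable borel"
      unfolding \<rho>_def by (rule borel_measurable_SUP) (use Z R in \<open>auto intro: countable_finite\<close>)
    have pw: "\<rho> x ^ CARD('n) \<le> (\<Sum>z\<in>Z. R z x ^ CARD('n))" for x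
    proof -
      have "Max ((\<lambda>z. R z x) ` Z) \<in> (\<lambda>z. R z x) ` Z" by (rule Max_in) (use Z Zne in auto)
      moreover have "\<rho> x = Max ((\<lambda>z. R z x) ` Z)"
        unfolding \<rho>_def by (rule cSup_eq_Max) (use Z Zne in auto)
      ultimately obtain z where "z \<in> Z" "\<rho> x = R z x" by auto
      then show ?thesis using Z(2) by (auto intro!: member_le_sum)
    qed
    have "(\<integral>\<^sup>+x. \<rho> x ^ CARD('n) \<partial>lborel) \<le> (\<integral>\<^sup>+x. (\<Sum>z\<in>Z. R z x ^ CARD('n)) \<partial>lborel)"
      by (rule nn_integral_mono) (rule pw)
    also have "\<dots> = (\<Sum>z\<in>Z. \<integral>\<^sup>+x. R z x ^ CARD('n) \<partial>lborel)"
      by (rule nn_integral_sum) (use R(1) in measurable)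
    also have "\<dots> \<le> of_nat (card Z) * C0" by (rule sum_bounded_above) (rule R(2))
    finally have "(\<integral>\<^sup>+x. \<rho> x ^ CARD('n) \<partial>lborel) \<le> of_nat (card Z) * C0" .
    moreover have "1 \<le> seg_int \<rho> a b" if ab: "Some ` closed_segment a b \<subseteq> D'"
      "e \<le> dist (g (Some a)) (g (Some b))" for a b
    proof -
      have "g (Some a) \<in> D" using ab gD by auto
      then obtain z where z: "z \<in> Z" "dist z (g (Some a)) < e / 4" using ZD by auto
      have "e / 2 < dist z (g (Some b))"
        using z(2) ab(2) dist_triangle3[of "g (Some a)" "g (Some b)" z] e by linarith
      then have "1 \<le> seg_int (R z) a b" using R(3)[OF z(1) ab(1)] z(2) by simp
      also have "\<dots> \<le> seg_int \<rho> a b" unfolding seg_int_def \<rho>_def using z(1)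
        by (intro mult_left_mono nn_integral_mono mult_right_mono SUP_upper) auto
      finally show ?thesis .
    qed
    ultimately show "\<exists>\<rho>\<in>borel_measurable borel. (\<integral>\<^sup>+x. \<rho> x ^ CARD('n) \<partial>lborel) \<le> of_nat (card Z) * C0 \<and>
     (\<forall>a b. Some ` closed_segment a b \<subseteq> D' \<longrightarrow> e \<le> dist (g (Some a)) (g (Some b)) \<longrightarrow> 1 \<le> seg_int \<rho> a b)"
      by (intro bexI[of _ \<rho>]) auto
  qed
qed

section \<open>Neighbourhoods in the extended space\<close>

text \<open>A ball of the maximum norm: its surface consists of pieces of coordinate hyperplanes, to
  which \<open>slice_int\<close> applies.\<close>

definition cube :: "'a::euclidean_space \<Rightarrow> real \<Rightarrow> 'a set" where
  "cube c r = {x. \<forall>j\<in>Basis. \<bar>(x - c) \<bullet> j\<bar> \<le> r}"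

definition open_cube :: "'a::euclidean_space \<Rightarrow> real \<Rightarrow> 'a set" where
  "open_cube c r = {x. \<forall>j\<in>Basis. \<bar>(x - c) \<bullet> j\<bar> < r}"

lemma cube_eq_cbox: "cube c r = cbox (c - r *\<^sub>R One) (c + r *\<^sub>R One)"
  by (auto simp: cube_def mem_box inner_diff_left inner_add_left abs_le_iff) (smt (verit))+

lemma open_cube_eq_box: "open_cube c r = box (c - r *\<^sub>R One) (c + r *\<^sub>R One)"
  by (auto simp: open_cube_def mem_box inner_diff_left inner_add_left abs_less_iff) (smt (verit))+

lemma cube_diff_open_cube: "cube c r - open_cube c r = cube_surface c r"
  by (auto simp: cube_def open_cube_def cube_surface_def) force+

lemma open_cube_mono: "r \<le> s \<Longrightarrow> open_cube c r \<subseteq> open_cube c s"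
  by (force simp: open_cube_def)

lemma cube_mono: "r \<le> s \<Longrightarrow> cube c r \<subseteq> cube c s"
  by (force simp: cube_def)

lemma open_cube_subset_cube: "open_cube c r \<subseteq> cube c r"
  by (force simp: cube_def open_cube_def)

lemma norm_cube_le:
  fixes c :: "'a::euclidean_space"
  assumes "x \<in> cube c r"
  shows "norm (x - c) \<le> real DIM('a) * r"
proof -
  have "norm (x - c) \<le> (\<Sum>j\<in>Basis. \<bar>(x - c) \<bullet> j\<bar>)" by (rule norm_le_l1)
  also have "\<dots> \<le> (\<Sum>j\<in>(Basis::'a set). r :: real)" by (rule sum_mono) (use assms in \<open>auto simp: cube_def\<close>)
  finally show ?thesis by simp
qed

lemma in_open_cube_of_norm: "norm (x - c) < r \<Longrightarrow> x \<in> open_cube c r"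
  using Basis_le_norm order_le_less_trans unfolding open_cube_def by blast

section \<open>Comparison of the chordal metric with the Euclidean norm\<close>

lemma chordal_ball_finite:
  fixes c :: "real ^ 'n"
  assumes r: "0 < r"
  obtains \<delta> where "0 < \<delta>" "\<And>y. chordal y (Some c) < \<delta> \<Longrightarrow> \<exists>x. y = Some x \<and> norm (x - c) < r"
proof -
  define s where "s = sqrt (1 + (norm c)\<^sup>2)"
  have s: "s > 0" by (simp add: s_def add_pos_nonneg)
  \<comment> \<open>A lower bound for the chordal distance to \<open>c\<close> of points at
    Euclidean distance at least \<open>r\<close>: it comes from
    \<open>sqrt (1 + (norm x)\<^sup>2) \<le> 1 + norm c + norm (x - c)\<close> and the monotonicity
    of \<open>t / (1 + norm c + t)\<close> in \<open>t\<close>.\<close>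
  define B where "B = r / ((1 + norm c + r) * s)"
  have B: "B > 0" using r s by (auto simp: B_def intro!: divide_pos_pos mult_pos_pos add_pos_nonneg)
  show ?thesis
  \<comment> \<open>The value \<open>1 / s\<close> is the chordal distance from \<open>c\<close> to
    infinity, so it excludes \<open>y = None\<close>.\<close>
  proof (rule that[of "min B (1 / s)"])
    fix y assume y: "chordal y (Some c) < min B (1 / s)"
    then obtain x where x: "y = Some x" by (cases y) (auto simp: s_def)
    have "norm (x - c) < r"
    proof (rule ccontr)
      assume "\<not> norm (x - c) < r"
      then have d: "r \<le> norm (x - c)" by simp
      let ?d = "norm (x - c)"
      have "sqrt (1 + (norm x)\<^sup>2) \<le> 1 + norm x"
        by (rule real_le_lsqrt) (auto simp: power2_eq_square algebra_simps)
      also have "\<dots> \<le> 1 + norm c + ?d" using norm_triangle_ineq2[of x c] by simp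
      finally have q: "sqrt (1 + (norm x)\<^sup>2) \<le> 1 + norm c + ?d" .
      have "r * (1 + norm c + ?d) \<le> ?d * (1 + norm c + r)"
        using mult_right_mono[OF d, of "1 + norm c"] by (simp add: algebra_simps)
      then have "r / (1 + norm c + r) \<le> ?d / (1 + norm c + ?d)"
        using r by (simp add: divide_simps add_pos_nonneg)
      also have "\<dots> \<le> ?d / sqrt (1 + (norm x)\<^sup>2)"
        using q by (intro divide_left_mono) (auto intro!: mult_pos_pos add_pos_nonneg)
      finally have "r / (1 + norm c + r) / s \<le> ?d / sqrt (1 + (norm x)\<^sup>2) / s"
        using s by (intro divide_right_mono) auto
      then have "B \<le> chordal y (Some c)" by (simp add: B_def x s_def)
      then show False using y by simp
    qed
    then show "\<exists>x. y = Some x \<and> norm (x - c) < r" using x by blast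
  qed (use B s in auto)
qed

lemma chordal_ball_infinity:
  obtains \<delta> where "0 < \<delta>"
    "\<And>y :: (real ^ 'n) option. chordal y None < \<delta> \<Longrightarrow> y = None \<or> (\<exists>x. y = Some x \<and> R < norm x)"
proof (rule that[of "1 / sqrt (1 + R\<^sup>2)"])
  fix y :: "(real ^ 'n) option" assume y: "chordal y None < 1 / sqrt (1 + R\<^sup>2)"
  show "y = None \<or> (\<exists>x. y = Some x \<and> R < norm x)"
  proof (cases y)
    case (Some x)
    have "sqrt (1 + R\<^sup>2) < sqrt (1 + (norm x)\<^sup>2)"
      using y Some by (simp add: field_simps add_pos_nonneg)
    then have "R < norm x" using power2_less_imp_less[of R "norm x"] by simp
    then show ?thesis using Some by auto
  qed simp
qed (simp add: add_pos_nonneg)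

section \<open>Cubic neighbourhoods in the one-point compactification\<close>

lemma Rbar_nbhd_finite:
  fixes D' :: "(real ^ 'n) option set"
  assumes "openin Rbar D'" "Some c \<in> D'"
  obtains R where "0 < R" "Some ` cube c R \<subseteq> D'"
proof -
  have "open {x. Some x \<in> D'}"
    using openin_continuous_map_preimage[OF continuous_map_Some assms(1)] by simp
  then obtain \<epsilon> where \<epsilon>: "\<epsilon> > 0" "ball c \<epsilon> \<subseteq> {x. Some x \<in> D'}"
    using assms(2) openE by blast
  define R where "R = \<epsilon> / (2 * real DIM(real ^ 'n))"
  have "cube c R \<subseteq> ball c \<epsilon>"
  proof
    fix x assume "x \<in> cube c R"
    then have "norm (x - c) \<le> real DIM(real ^ 'n) * R" by (rule norm_cube_le)
    also have "\<dots> < \<epsilon>" using \<epsilon> by (simp add: R_def)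
    finally show "x \<in> ball c \<epsilon>" by (simp add: dist_norm norm_minus_commute)
  qed
  moreover have "R > 0" using \<epsilon> by (simp add: R_def)
  ultimately show ?thesis using that[of R] \<epsilon>(2) by blast
qed

lemma Rbar_nbhd_infinity:
  fixes D' :: "(real ^ 'n) option set"
  assumes "openin Rbar D'" "None \<in> D'"
  obtains R where "0 < R" "- Some ` open_cube 0 R \<subseteq> D'"
proof -
  obtain C where C: "compact C" "D' = insert None (Some ` (UNIV - C))"
    using assms by (auto simp: openin_Alexandroff_compactification)
  then obtain B where B: "B > 0" "\<And>x. x \<in> C \<Longrightarrow> norm x \<le> B"
    using compact_imp_bounded[OF C(1)] unfolding bounded_pos by blast
  \<comment> \<open>Points outside this open cube have norm at least \<open>B + 1\<close> and so
    avoid the compact set \<open>C\<close>.\<close>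
  have "- Some ` open_cube 0 (B + 1) \<subseteq> D'"
  proof
    fix y assume y: "y \<in> - Some ` open_cube (0 :: real ^ 'n) (B + 1)"
    show "y \<in> D'"
    proof (cases y)
      case (Some x)
      then have "x \<notin> open_cube 0 (B + 1)" using y by auto
      then have "\<not> norm (x - 0) < B + 1" using in_open_cube_of_norm by blast
      then have "x \<notin> C" using B(2)[of x] by auto
      then show ?thesis using C(2) Some by auto
    qed (use assms in simp)
  qed
  then show ?thesis using that[of "B + 1"] B(1) by auto
qed

lemma Rbar_cube:
  fixes c :: "real ^ 'n"
  shows "openin Rbar (Some ` open_cube c r)" "compactin Rbar (Some ` cube c r)"
    "openin Rbar (- Some ` cube c r)" "compactin Rbar (- Some ` open_cube c r)"
proof -
  show o: "openin Rbar (Some ` open_cube c r)" by (simp add: open_cube_eq_box open_box)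
  have cc: "compact (cube c r)" by (simp add: cube_eq_cbox)
  show "compactin Rbar (Some ` cube c r)"
    using image_compactin[OF _ continuous_map_Some, of euclidean "cube c r"] cc by simp
  have top: "topspace (Rbar :: (real ^ 'n) option topology) - S = - S" for S
    using topspace_subtopology_Rbar[of UNIV] by auto
  have "closedin Rbar (Some ` cube c r)" using cc by (simp add: compact_imp_closed)
  then show "openin Rbar (- Some ` cube c r)"
    unfolding closedin_def top by blast
  have "closedin Rbar (- Some ` open_cube c r)"
    using openin_closedin_eq[of Rbar "Some ` open_cube c r"] o unfolding top by blast
  then show "compactin Rbar (- Some ` open_cube c r)"
    by (rule closedin_compact_space[OF compact_space_Alexandroff_compactification])
qed

section \<open>Equicontinuity\<close>

text \<open>The frontier argument is carried out on the image side, so \<open>K\<close> may contain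
  infinity. Since \<open>D\<close> is open, \<open>g\<close> maps \<open>U\<close> to an open subset
  of Euclidean space, hence the frontier of \<open>g\<close> K\<open>lies in\<close>g
  \<open>(K - U)\<close>.\<close>

lemma exists_frontier_pair_homeo:
  fixes D :: "(real ^ 'n) set" and D' :: "(real ^ 'n) option set"
  assumes g: "homeomorphic_map (subtopology Rbar D') (top_of_set D) g" and D: "open D"
    and K: "compactin Rbar K" "K \<subseteq> D'" and U: "openin Rbar U" "U \<subseteq> K"
    and x: "x \<in> K" and y: "y \<in> K"
  obtains p q where "p \<in> K - U" "q \<in> K - U" "dist (g x) (g y) \<le> dist (g p) (g q)"
proof -
  have "compactin (subtopology Rbar D') K" using K by (simp add: compactin_subtopology)
  then have "compactin (top_of_set D) (g ` K)"
    using homeomorphic_imp_continuous_map[OF g] by (rule image_compactin)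
  then have cK: "compact (g ` K)" by (simp add: compactin_subtopology)
  have "openin (subtopology Rbar D') U"
    using U K(2) by (auto simp: openin_subtopology_alt)
  then have "openin (top_of_set D) (g ` U)"
    using homeomorphic_imp_open_map[OF g] by (auto simp: open_map_def)
  then have oU: "open (g ` U)" using D openin_open_eq by blast
  have fr: "frontier (g ` K) \<subseteq> g ` (K - U)"
  proof -
    have "g ` U \<subseteq> interior (g ` K)" using oU U(2) by (intro interior_maximal) auto
    moreover have "closure (g ` K) = g ` K" using cK by (simp add: compact_imp_closed closure_closed)
    ultimately show ?thesis by (auto simp: frontier_def)
  qed
  obtain p q where "p \<in> frontier (g ` K)" "q \<in> frontier (g ` K)" "dist (g x) (g y) \<le> dist p q"
    using exists_frontier_pair[OF cK, of "g x" "g y"] x y by auto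
  then show ?thesis using fr that by blast
qed


text \<open>Treats finite points and infinity together: \<open>K r\<close> will be a cube or the
  complement of an open cube, and in both cases \<open>K r - U r\<close> is the cube surface that
  supplies the oscillation.\<close>

lemma ln_ratio_le_of_spread:
  fixes D :: "(real ^ 'n) set" and D' :: "(real ^ 'n) option set" and c :: "real ^ 'n"
  assumes dim: "CARD('n) \<ge> 2" and D: "open D"
    and g: "homeomorphic_map (subtopology Rbar D') (top_of_set D) g"
    and r12: "0 < r1" "r1 \<le> r2" and e: "0 < e" "e \<le> dist (g x) (g y)"
    and \<rho>: "\<rho> \<in> borel_measurable borel"
    and long: "\<And>a b. Some ` closed_segment a b \<subseteq> D' \<Longrightarrow> e / 6 \<le> dist (g (Some a)) (g (Some b)) \<Longrightarrow>
          1 \<le> seg_int \<rho> a b"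
    and K: "\<And>r. r1 \<le> r \<Longrightarrow> r \<le> r2 \<Longrightarrow> compactin Rbar (K r) \<and> K r \<subseteq> D' \<and> openin Rbar (U r) \<and>
          U r \<subseteq> K r \<and> K r - U r = Some ` cube_surface c r \<and> x \<in> K r \<and> y \<in> K r"
  shows "ennreal (inverse ((8 * (real CARD('n))\<^sup>2) ^ CARD('n)) * ln (r2 / r1))
     \<le> of_nat (2 * CARD('n)) * (\<integral>\<^sup>+x. \<rho> x ^ CARD('n) \<partial>lborel)"
proof -
  have *: "\<exists>p\<in>cube_surface c r. \<exists>q\<in>cube_surface c r. e \<le> dist ((g \<circ> Some) p) ((g \<circ> Some) q)"
    if r: "r1 \<le> r" "r \<le> r2" for r
  proof -
    note Kr = K[OF r]
    obtain p q where "p \<in> K r - U r" "q \<in> K r - U r" "dist (g x) (g y) \<le> dist (g p) (g q)"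
      using exists_frontier_pair_homeo[OF g D, of "K r" "U r" x y] Kr by blast
    moreover from this obtain a b where "p = Some a" "q = Some b" "a \<in> cube_surface c r" "b \<in> cube_surface c r"
      using Kr by auto
    ultimately show ?thesis using e by (intro bexI[of _ a] bexI[of _ b]) auto
  qed
  have long': "1 \<le> seg_int \<rho> a z" if r: "r1 \<le> r" "r \<le> r2" and "closed_segment a z \<subseteq> cube_surface c r"
    "e / 6 \<le> dist ((g \<circ> Some) a) ((g \<circ> Some) z)" for r a z
  proof (rule long)
    have "Some ` closed_segment a z \<subseteq> K r - U r" using K[OF r] that(3) by auto
    then show "Some ` closed_segment a z \<subseteq> D'" using K[OF r] by blast
  qed (use that in auto)
  have "DIM(real ^ 'n) \<ge> 2" using dim by simp
  from ln_ratio_le_nn_integral_power[OF this r12 e(1) \<rho> * long']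
  show ?thesis by simp
qed

theorem theorem1p1:
  fixes D :: "(real ^ 'n) set"
    and D' :: "(real ^ 'n) option set"
    and Q :: "real ^ 'n \<Rightarrow> ennreal"
  assumes "CARD('n) \<ge> 2"
    and "open D" "connected D" "D \<noteq> {}" "bounded D"
    and "openin Rbar D'" "connectedin Rbar D'" "D' \<noteq> {}"
    and "Q \<in> borel_measurable lebesgue"
    and "\<And>x. x \<notin> D \<Longrightarrow> Q x = 0"
    and "(\<integral>\<^sup>+ x \<in> D. Q x \<partial>lebesgue) < \<infinity>"
  shows "\<forall>y0\<in>D'. \<forall>\<epsilon>>0. \<exists>\<delta>>0. \<forall>g\<in>ring_family Q D D'. \<forall>y\<in>D'.
           chordal y y0 < \<delta> \<longrightarrow> norm (g y - g y0) < \<epsilon>"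
proof (intro ballI allI impI)
  fix y0 and \<epsilon> :: real assume y0: "y0 \<in> D'" and \<epsilon>: "0 < \<epsilon>"
  let ?N = "CARD('n)"
  define A where "A = inverse ((8 * (real ?N)\<^sup>2) ^ ?N)"
  have A: "A > 0" by (simp add: A_def)
  \<comment> \<open>The threshold \<open>\<epsilon> / 6\<close> is what remains of
    \<open>\<epsilon>\<close> after passing to one face (a third) and to one of two end points (a
    half).\<close>
  obtain C where C: "C < \<infinity>" and dens: "\<And>g. g \<in> ring_family Q D D' \<Longrightarrow>
     \<exists>\<rho>\<in>borel_measurable borel. (\<integral>\<^sup>+x. \<rho> x ^ CARD('n) \<partial>lborel) \<le> C \<and>
     (\<forall>a b. Some ` closed_segment a b \<subseteq> D' \<longrightarrow> \<epsilon> / 6 \<le> dist (g (Some a)) (g (Some b)) \<longrightarrow> 1 \<le> seg_int \<rho> a b)"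
    using ring_family_density[OF assms(2,5,4) _ assms(9,11), of "\<epsilon> / 6" D'] \<epsilon> by auto
  have "of_nat (2 * ?N) * C < \<infinity>"
    using C by (simp add: ennreal_mult_less_top ennreal_of_nat_eq_real_of_nat del: of_nat_mult)
  then obtain X where X: "of_nat (2 * ?N) * C = ennreal X" "0 \<le> X"
    unfolding infinity_ennreal_def less_top_ennreal by blast
  \<comment> \<open>Chosen so that \<open>A * M = X + 1\<close>; cubes with ratio of radii
    \<open>exp M\<close> then violate the logarithmic bound by \<open>X\<close>.\<close>
  define M where "M = (X + 1) / A"
  have M: "M > 0" "A * M > X" using A X by (auto simp: M_def)
  have small: "norm (g y - g y0) < \<epsilon>"
    if g: "g \<in> ring_family Q D D'" and r12: "0 < r1" "r2 = r1 * exp M"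
    and K: "\<And>r. r1 \<le> r \<Longrightarrow> r \<le> r2 \<Longrightarrow> compactin Rbar (K r) \<and> K r \<subseteq> D' \<and> openin Rbar (U r) \<and>
          U r \<subseteq> K r \<and> K r - U r = Some ` cube_surface c r \<and> y \<in> K r \<and> y0 \<in> K r"
    for g r1 r2 K U c y
  proof (rule ccontr)
    assume "\<not> norm (g y - g y0) < \<epsilon>"
    then have d: "\<epsilon> \<le> dist (g y) (g y0)" by (simp add: dist_norm)
    have hom: "homeomorphic_map (subtopology Rbar D') (top_of_set D) g"
      using g by (simp add: ring_family_def)
    obtain \<rho> where \<rho>: "\<rho> \<in> borel_measurable borel" "(\<integral>\<^sup>+x. \<rho> x ^ ?N \<partial>lborel) \<le> C"
      and long: "\<And>a b. Some ` closed_segment a b \<subseteq> D' \<Longrightarrow> \<epsilon> / 6 \<le> dist (g (Some a)) (g (Some b)) \<Longrightarrow>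
          1 \<le> seg_int \<rho> a b"
      using dens[OF g] by blast
    have "r1 * 1 \<le> r1 * exp M" using r12 M by (intro mult_left_mono) auto
    then have le: "r1 \<le> r2" using r12 by simp
    have "ennreal (A * ln (r2 / r1)) \<le> of_nat (2 * ?N) * (\<integral>\<^sup>+x. \<rho> x ^ ?N \<partial>lborel)"
      unfolding A_def
      by (rule ln_ratio_le_of_spread[OF assms(1,2) hom r12(1) le \<epsilon> d \<rho>(1) long K])
    also have "\<dots> \<le> of_nat (2 * ?N) * C" by (intro mult_left_mono \<rho>(2)) simp
    also have "\<dots> = ennreal X" by (rule X)
    finally have "A * ln (r2 / r1) \<le> X" using X by (simp add: ennreal_le_iff)
    moreover have "ln (r2 / r1) = M" using r12 by simp
    ultimately show False using M by simp
  qed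
  show "\<exists>\<delta>>0. \<forall>g\<in>ring_family Q D D'. \<forall>y\<in>D'. chordal y y0 < \<delta> \<longrightarrow> norm (g y - g y0) < \<epsilon>"
  proof (cases y0)
    case (Some c)
    obtain R where R: "0 < R" "Some ` cube c R \<subseteq> D'"
      using Rbar_nbhd_finite assms(6) y0 Some by blast
    \<comment> \<open>At a finite point the outer radius \<open>R\<close> is given by
      \<open>D'\<close>, and the inner one is shrunk to reach the ratio
      \<open>exp M\<close>.\<close>
    define r1 where "r1 = R * exp (- M)"
    have r1: "r1 > 0" using R by (simp add: r1_def)
    have Rr: "R = r1 * exp M" by (simp add: r1_def mult.assoc flip: exp_add)
    obtain \<delta> where \<delta>: "0 < \<delta>" "\<And>y. chordal y (Some c) < \<delta> \<Longrightarrow> \<exists>x. y = Some x \<and> norm (x - c) < r1"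
      using chordal_ball_finite[OF r1] by blast
    show ?thesis
    proof (intro exI[of _ \<delta>] conjI ballI impI)
      fix g y assume g: "g \<in> ring_family Q D D'" and y: "chordal y y0 < \<delta>"
      obtain x where x: "y = Some x" "norm (x - c) < r1" using \<delta>(2) y Some by blast
      show "norm (g y - g y0) < \<epsilon>"
      proof (rule small[OF g r1 Rr, where K = "\<lambda>r. Some ` cube c r" and U = "\<lambda>r. Some ` open_cube c r" and c = c])
        fix r assume r: "r1 \<le> r" "r \<le> R"
        have "x \<in> cube c r" using in_open_cube_of_norm[of x c r] open_cube_subset_cube x r by fastforce
        moreover have "c \<in> cube c r" using r r1 by (simp add: cube_def)
        moreover have "Some ` cube c r - Some ` open_cube c r = Some ` cube_surface c r"
          unfolding cube_diff_open_cube[symmetric] by auto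
        moreover have "Some ` cube c r \<subseteq> D'" using R(2) cube_mono[OF r(2), of c] by blast
        ultimately show "compactin Rbar (Some ` cube c r) \<and> Some ` cube c r \<subseteq> D' \<and>
          openin Rbar (Some ` open_cube c r) \<and> Some ` open_cube c r \<subseteq> Some ` cube c r \<and>
          Some ` cube c r - Some ` open_cube c r = Some ` cube_surface c r \<and> y \<in> Some ` cube c r \<and> y0 \<in> Some ` cube c r"
          using x(1) Some
          by (intro conjI Rbar_cube image_mono open_cube_subset_cube) auto
      qed
    qed (use \<delta> in simp)
  next
    case None
    obtain R where R: "0 < R" "- Some ` open_cube 0 R \<subseteq> D'"
      using Rbar_nbhd_infinity assms(6) y0 None by blast
    \<comment> \<open>At infinity \<open>R\<close> is the inner radius, and the cubes grow outwards.
      Points of norm above the dimension times \<open>r2\<close> lie outside every cube considered,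
      which determines \<open>\<delta>\<close>.\<close>
    define r2 where "r2 = R * exp M"
    obtain \<delta> where \<delta>: "0 < \<delta>" "\<And>y :: (real ^ 'n) option. chordal y None < \<delta> \<Longrightarrow>
        y = None \<or> (\<exists>x. y = Some x \<and> real DIM(real ^ 'n) * r2 < norm x)"
      using chordal_ball_infinity[of "real DIM(real ^ 'n) * r2"] by blast
    show ?thesis
    proof (intro exI[of _ \<delta>] conjI ballI impI)
      fix g y assume g: "g \<in> ring_family Q D D'" and y: "chordal y y0 < \<delta>"
      show "norm (g y - g y0) < \<epsilon>"
      proof (rule small[OF g R(1) r2_def, where K = "\<lambda>r. - Some ` open_cube 0 r" and U = "\<lambda>r. - Some ` cube 0 r" and c = 0])
        fix r assume r: "R \<le> r" "r \<le> r2"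
        have "y \<in> - Some ` open_cube 0 r"
        proof
          assume "y \<in> Some ` open_cube 0 r"
          then obtain x where x: "y = Some x" "x \<in> open_cube 0 r" by auto
          then have "x \<in> cube 0 r2" using open_cube_subset_cube cube_mono[OF r(2)] by blast
          then have "norm (x - 0) \<le> real DIM(real ^ 'n) * r2" by (rule norm_cube_le)
          then show False using \<delta>(2)[of y] y None x by auto
        qed
        moreover have "- Some ` open_cube 0 r - - Some ` cube 0 r = Some ` cube_surface (0 :: real ^ 'n) r"
          unfolding cube_diff_open_cube[symmetric] by auto
        ultimately show "compactin Rbar (- Some ` open_cube (0 :: real ^ 'n) r) \<and> - Some ` open_cube 0 r \<subseteq> D' \<and>
          openin Rbar (- Some ` cube (0 :: real ^ 'n) r) \<and> - Some ` cube 0 r \<subseteq> - Some ` open_cube (0 :: real ^ 'n) r \<and>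
          - Some ` open_cube 0 r - - Some ` cube 0 r = Some ` cube_surface (0 :: real ^ 'n) r \<and>
          y \<in> - Some ` open_cube 0 r \<and> y0 \<in> - Some ` open_cube 0 r"
          using R(2) open_cube_mono[OF r(1), of "0 :: real ^ 'n"] None
          by (intro conjI Rbar_cube Compl_anti_mono image_mono open_cube_subset_cube) blast+
      qed
    qed (use \<delta> in simp)
  qed
qed

end
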